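(* (i) The set of equilibria attainable by a bounded purely rank-based reward is $$\mathcal{E}(\mathcal{R}_b^r)=\{\mu\in\mathcal{P}^+(\mathbb{R}):\ \zeta_\mu\text{ and }1/\zeta_\mu\text{ are bounded and }\zeta_\mu\text{ is increasing}\}.$$ (ii) If $\mu\in\mathcal{E}(\mathcal{R}_b^r)$, then $$\mathcal{E}^{-1}(\mu)=\{2c\sigma^2\ln\zeta_\mu(q_\mu(r))+C:\ C\in\mathbb{R}\}.$$ (iii) Let $\mu\in\mathcal{E}(\mathcal{R}_b^r)$ and $V_0,K\in\mathbb{R}$. If one imposes in addition the reservation utility constraint $\mathcal{V}(R)\ge V_0$ and the budget constraint $\int_0^1R(r)dr\le K$ on $R(r)=2c\sigma^2\ln\zeta_\mu(q_\mu(r))+C$, then the constant $C$ is restricted exactly to $$V_0\le C\le K-2c\sigma^2H\left(\mu\,|\,\mathcal{N}(x_0,\sigma^2T)\right),$$ where $$H\left(\mu\,|\,\mathcal{N}(x_0,\sigma^2T)\right)=\int_{-\infty}^\infty\ln\zeta_\mu(y)\,d\mu(y)=\int_0^1\ln\zeta_\mu(q_\mu(r))\,dr.$$ In particular, such a $C$ exists if and only if $$H\left(\mu\,|\,\mathcal{N}(x_0,\sigma^2T)\right)\le\frac{K-V_0}{2c\sigma^2}.$$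
   Context: Fix constants $T,\sigma,c>0$ and $x_0\in\mathbb{R}$. Let $f_0$ be the density of $\mathcal{N}(x_0,\sigma^2T)$. "Increasing" is understood in the weak sense. $\mathcal{R}_b^r$ is the set of bounded increasing functions $R:[0,1]\to\mathbb{R}$ (bounded purely rank-based rewards). $H(\cdot|\cdot)$ is relative entropy, $H(Q|P)=E^Q[\ln(dQ/dP)]$. Game: let $\Omega=C([0,T],\mathbb{R})$ with canonical process $X$, and let $P$ be the law on $\Omega$ of $(x_0+\sigma B_t)_{t\in[0,T]}$, $B$ a standard Brownian motion started at $0$. Let $\mathcal{Q}=\{Q\in\mathcal{P}(\Omega):Q\sim P\}$ (mutually absolutely continuous), and write $Q_T$ for the law of $X_T$ under $Q$. With $F_{\tilde\mu}$ the c.d.f. of $\tilde\mu\in\mathcal{P}(\mathbb{R})$, put $$V(R,\tilde\mu):=\sup_{Q\in\mathcal{Q}}\left\{E^Q\left[R(F_{\tilde\mu}(X_T))\right]-2c\sigma^2H(Q|P)\right\}.$$ A probability measure $\mu$ on $\mathbb{R}$ is an equilibrium for $R$ if $\mu=Q_T$ for some $Q\in\mathcal{Q}$ attaining the supremum $V(R,\mu)$. Each $R\in\mathcal{R}_b^r$ has exactly one equilibrium, denoted $\mathcal{E}(R)$; this defines a map $\mathcal{E}:\mathcal{R}_b^r\to\mathcal{P}(\mathbb{R})$. The game value is $\mathcal{V}(R):=V(R,\mathcal{E}(R))$. $\mathcal{P}^+(\mathbb{R})$ is the set of probability measures on $\mathbb{R}$ having a strictly positive density. For $\mu\in\mathcal{P}^+(\mathbb{R})$,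 $f_\mu$ is its density, $q_\mu$ its quantile function, and $\zeta_\mu:=f_\mu/f_0$ its normalized density. Conventions: densities are defined up to Lebesgue-null sets, and the conditions on $\zeta_\mu$ are required for some version, which is the version used in (ii) and (iii). Reward functions on $[0,1]$ that agree Lebesgue-almost everywhere are identified (in particular the values at $r=0,1$ are immaterial). *)

theory Defs
  imports "HOL-Probability.Probability"
begin

section \<open>Brownian motion and path space\<close>

definition standard_brownian_motion ::
    "real \<Rightarrow> 'w measure \<Rightarrow> (real \<Rightarrow> 'w \<Rightarrow> real) \<Rightarrow> bool" where
  "standard_brownian_motion T M B \<longleftrightarrow>
     prob_space M \<and>
     (\<forall>t\<in>{0..T}. B t \<in> borel_measurable M) \<and>
     (\<forall>\<omega>\<in>space M. B 0 \<omega> = 0) \<and>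
     (\<forall>\<omega>\<in>space M. continuous_on {0..T} (\<lambda>t. B t \<omega>)) \<and>
     (\<forall>s t. 0 \<le> s \<and> s < t \<and> t \<le> T \<longrightarrow>
        distributed M lborel (\<lambda>\<omega>. B t \<omega> - B s \<omega>) (normal_density 0 (sqrt (t - s)))) \<and>
     (\<forall>n (\<tau> :: nat \<Rightarrow> real).
        (\<forall>i\<le>n. \<tau> i \<in> {0..T}) \<and> (\<forall>i<n. \<tau> i \<le> \<tau> (Suc i)) \<longrightarrow>
        prob_space.indep_vars M (\<lambda>_. borel) (\<lambda>i \<omega>. B (\<tau> (Suc i)) \<omega> - B (\<tau> i) \<omega>) {..<n})"

text \<open>The space \<open>C([0,T],\<real>)\<close>, paths being represented by functions on the reals that are
  \<open>undefined\<close> off \<open>[0,T]\<close>. The sigma-algebra is the one generated by the coordinate maps; it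
  coincides with the Borel sigma-algebra of the uniform topology.\<close>

definition path_space :: "real \<Rightarrow> (real \<Rightarrow> real) measure" where
  "path_space T =
     restrict_space (\<Pi>\<^sub>M t\<in>{0..T}. borel) {\<omega>. continuous_on {0..T} \<omega>}"

definition reference_law ::
    "real \<Rightarrow> real \<Rightarrow> real \<Rightarrow> 'w measure \<Rightarrow> (real \<Rightarrow> 'w \<Rightarrow> real) \<Rightarrow> (real \<Rightarrow> real) measure" where
  "reference_law T \<sigma> x0 M B =
     distr M (path_space T) (\<lambda>w. \<lambda>t\<in>{0..T}. x0 + \<sigma> * B t w)"


section \<open>Relative entropy\<close>

text \<open>\<open>H(Q|P) = E\<^sup>Q[ln (dQ/dP)]\<close> with values in \<open>[0,\<infinity>]\<close>. The library constant
  \<^const>\<open>KL_divergence\<close> with base \<open>e\<close> is this expectation as a Bochner integral, which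
  is 0 by convention for non-integrable functions. As the negative part of \<open>ln (dQ/dP)\<close> is
  always \<open>Q\<close>-integrable, non-integrability means that the expectation is \<open>\<infinity>\<close>.\<close>

definition relative_entropy :: "'a measure \<Rightarrow> 'a measure \<Rightarrow> ereal" where
  "relative_entropy Q P =
     (if absolutely_continuous P Q \<and> integrable Q (entropy_density (exp 1) P Q)
      then ereal (KL_divergence (exp 1) P Q) else \<infinity>)"


section \<open>The game\<close>

text \<open>The set \<open>\<R>\<^sub>b\<^sup>r\<close>; only the values of a reward on \<open>[0,1]\<close> matter.\<close>

definition rank_rewards :: "(real \<Rightarrow> real) set" where
  "rank_rewards = {R. bounded (R ` {0..1}) \<and> mono_on {0..1} R}"

text \<open>Rewards that agree almost everywhere on \<open>[0,1]\<close> are identified; statements about such classes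
  are made for all their representatives in \<^const>\<open>rank_rewards\<close>.\<close>

definition reward_eq :: "(real \<Rightarrow> real) \<Rightarrow> (real \<Rightarrow> real) \<Rightarrow> bool" where
  "reward_eq R R' \<longleftrightarrow> (AE r in lborel. r \<in> {0..1} \<longrightarrow> R r = R' r)"

definition equivalent_laws :: "'a measure \<Rightarrow> 'a measure set" where
  "equivalent_laws P =
     {Q. prob_space Q \<and> sets Q = sets P \<and> absolutely_continuous P Q \<and> absolutely_continuous Q P}"

definition terminal_law :: "real \<Rightarrow> (real \<Rightarrow> real) measure \<Rightarrow> real measure" where
  "terminal_law T Q = distr Q borel (\<lambda>\<omega>. \<omega> T)"

definition objective ::
    "real \<Rightarrow> real \<Rightarrow> real \<Rightarrow> (real \<Rightarrow> real) measure \<Rightarrow> (real \<Rightarrow> real) \<Rightarrow> real measure \<Rightarrow>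
     (real \<Rightarrow> real) measure \<Rightarrow> ereal" where
  "objective T \<sigma> c P R \<mu> Q =
     ereal (LINT \<omega>|Q. R (cdf \<mu> (\<omega> T))) - ereal (2 * c * \<sigma>\<^sup>2) * relative_entropy Q P"

definition best_response_value ::
    "real \<Rightarrow> real \<Rightarrow> real \<Rightarrow> (real \<Rightarrow> real) measure \<Rightarrow> (real \<Rightarrow> real) \<Rightarrow> real measure \<Rightarrow> ereal" where
  "best_response_value T \<sigma> c P R \<mu> = (SUP Q\<in>equivalent_laws P. objective T \<sigma> c P R \<mu> Q)"

definition is_equilibrium ::
    "real \<Rightarrow> real \<Rightarrow> real \<Rightarrow> (real \<Rightarrow> real) measure \<Rightarrow> (real \<Rightarrow> real) \<Rightarrow> real measure \<Rightarrow> bool" where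
  "is_equilibrium T \<sigma> c P R \<mu> \<longleftrightarrow>
     (\<exists>Q\<in>equivalent_laws P. \<mu> = terminal_law T Q \<and>
        objective T \<sigma> c P R \<mu> Q = best_response_value T \<sigma> c P R \<mu>)"

text \<open>The description is proper for every \<open>R\<close> in \<^const>\<open>rank_rewards\<close>: such an \<open>R\<close> has exactly one
  equilibrium. For other functions the value is irrelevant.\<close>

definition equilibrium ::
    "real \<Rightarrow> real \<Rightarrow> real \<Rightarrow> (real \<Rightarrow> real) measure \<Rightarrow> (real \<Rightarrow> real) \<Rightarrow> real measure" where
  "equilibrium T \<sigma> c P R = (THE \<mu>. is_equilibrium T \<sigma> c P R \<mu>)"

definition game_value ::
    "real \<Rightarrow> real \<Rightarrow> real \<Rightarrow> (real \<Rightarrow> real) measure \<Rightarrow> (real \<Rightarrow> real) \<Rightarrow> ereal" where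
  "game_value T \<sigma> c P R = best_response_value T \<sigma> c P R (equilibrium T \<sigma> c P R)"


section \<open>Densities and quantiles\<close>

definition positive_density :: "real measure \<Rightarrow> (real \<Rightarrow> real) \<Rightarrow> bool" where
  "positive_density \<mu> f \<longleftrightarrow>
     f \<in> borel_measurable borel \<and> (\<forall>x. 0 < f x) \<and> \<mu> = density lborel f"

definition positive_laws :: "real measure set" where
  "positive_laws = {\<mu>. prob_space \<mu> \<and> sets \<mu> = sets borel \<and> (\<exists>f. positive_density \<mu> f)}"

text \<open>The density \<open>f\<^sub>0\<close> of \<open>N(x\<^sub>0, \<sigma>\<^sup>2 T)\<close>; \<^const>\<open>normal_density\<close> takes the standard
  deviation as parameter.\<close>

definition ref_density :: "real \<Rightarrow> real \<Rightarrow> real \<Rightarrow> real \<Rightarrow> real" where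
  "ref_density T \<sigma> x0 = normal_density x0 (\<sigma> * sqrt T)"

definition normalized_density ::
    "real \<Rightarrow> real \<Rightarrow> real \<Rightarrow> real measure \<Rightarrow> (real \<Rightarrow> real) \<Rightarrow> bool" where
  "normalized_density T \<sigma> x0 \<mu> \<zeta> \<longleftrightarrow>
     (\<exists>f. positive_density \<mu> f \<and> \<zeta> = (\<lambda>x. f x / ref_density T \<sigma> x0 x))"

text \<open>Densities being determined up to null sets, \<open>\<zeta>\<close> ranges over the versions that satisfy the
  boundedness and monotonicity conditions.\<close>

definition admissible_version ::
    "real \<Rightarrow> real \<Rightarrow> real \<Rightarrow> real measure \<Rightarrow> (real \<Rightarrow> real) \<Rightarrow> bool" where
  "admissible_version T \<sigma> x0 \<mu> \<zeta> \<longleftrightarrow>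
     normalized_density T \<sigma> x0 \<mu> \<zeta> \<and>
     bounded (range \<zeta>) \<and> bounded (range (\<lambda>x. 1 / \<zeta> x)) \<and> mono \<zeta>"

text \<open>Meaningful for \<open>0 < r < 1\<close> only: for \<open>r = 0\<close>, and for \<open>r = 1\<close> if \<open>\<mu>\<close> has unbounded support,
  the value of \<^const>\<open>Inf\<close> is unspecified.\<close>

definition quantile :: "real measure \<Rightarrow> real \<Rightarrow> real" where
  "quantile \<mu> r = Inf {x. r \<le> cdf \<mu> x}"

definition implementing_reward ::
    "real \<Rightarrow> real \<Rightarrow> real measure \<Rightarrow> (real \<Rightarrow> real) \<Rightarrow> real \<Rightarrow> real \<Rightarrow> real" where
  "implementing_reward \<sigma> c \<mu> \<zeta> C = (\<lambda>r. 2 * c * \<sigma>\<^sup>2 * ln (\<zeta> (quantile \<mu> r)) + C)"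

end

theory Submission
  imports Defs
begin

text \<open>
  Put \<open>\<beta> = 2 c \<sigma>\<^sup>2\<close> and let \<open>N\<close> be the terminal law of the reference measure \<open>P\<close>, a normal law.

  For a bounded reward \<open>g\<close> of the path, the functional \<open>Q \<mapsto> E\<^sup>Q[g] - \<beta> H(Q|P)\<close> differs from the
  constant \<open>\<beta> ln Z\<close>, \<open>Z = E\<^sup>P[exp (g/\<beta>)]\<close>, by \<open>- \<beta> H(Q|G)\<close>, where \<open>G\<close> is the Gibbs measure with
  density \<open>exp (g/\<beta>) / Z\<close> (\<open>gibbs_variational_identity\<close>). So the best response is \<open>G\<close>, and nothing
  else. As \<open>g\<close> is here a function of the terminal value, passing to terminal laws shows that \<open>\<mu>\<close> is
  an equilibrium for \<open>R\<close> if and only if \<open>\<mu>\<close> is the Gibbs measure of \<open>N\<close> for \<open>R \<circ> F\<^sub>\<mu>\<close>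
  (\<open>is_equilibrium_iff_gibbs_measure\<close>); from here on everything happens on the real line.

  The fixed-point problem is solved in rank coordinates. Gibbs tilting by \<open>g\<close> is undone by tilting
  by \<open>-g\<close>, so it amounts to saying that tilting \<open>\<mu>\<close> by \<open>- R \<circ> F\<^sub>\<mu>\<close> gives \<open>N\<close>. Now \<open>\<mu>\<close> is the image of the
  uniform law on \<open>(0,1)\<close> under its quantile function \<open>q\<^sub>\<mu>\<close>, and \<open>F\<^sub>\<mu> \<circ> q\<^sub>\<mu>\<close> is the identity because \<open>\<mu>\<close>
  has no atoms. Hence the condition is that \<open>q\<^sub>\<mu>\<close> maps the uniform law tilted by \<open>-R\<close>, which is known, to
  \<open>N\<close>. With \<open>\<Phi>\<close> the c.d.f. of that tilted law this reads \<open>\<Phi> \<circ> F\<^sub>\<mu> = F\<^sub>N\<close>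
  (\<open>gibbs_fixed_point_iff\<close>). As \<open>\<Phi>\<close> is an increasing homeomorphism of \<open>[0,1]\<close>, there is exactly
  one solution, the image of the uniform law under \<open>q\<^sub>N \<circ> \<Phi>\<close> (\<open>gibbs_fixed_point_ex1\<close>).

  Finally, if \<open>\<mu>\<close> has density \<open>\<zeta>\<close> with respect to \<open>N\<close>, then being the Gibbs measure for
  \<open>R \<circ> F\<^sub>\<mu>\<close> means \<open>R (F\<^sub>\<mu> x) = \<beta> ln (\<zeta> x) + C\<close> for almost all \<open>x\<close>, with \<open>C = \<beta> ln Z\<close>; in rank
  coordinates, \<open>R r = \<beta> ln (\<zeta> (q\<^sub>\<mu> r)) + C\<close> for almost all \<open>r\<close>. The assumptions on \<open>R\<close> and those on
  \<open>\<zeta>\<close> correspond to each other under this equation, and \<open>C\<close> is the value of the game. The mean reward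
  is \<open>\<beta> H(\<mu>|N) + C\<close>, since \<open>q\<^sub>\<mu>\<close> maps the uniform law to \<open>\<mu>\<close>, so the two constraints bound \<open>C\<close> from
  below and from above.
\<close>

section \<open>Relative entropy and the Gibbs variational principle\<close>

lemma entropy_density_density:
  assumes "sigma_finite_measure P"
    and E: "E \<in> borel_measurable P" "\<And>x. x \<in> space P \<Longrightarrow> 0 \<le> E x"
  shows "AE x in density P (\<lambda>x. ennreal (E x)).
           entropy_density (exp 1) P (density P (\<lambda>x. ennreal (E x))) x = ln (E x)"
proof -
  interpret sigma_finite_measure P by fact
  have "AE x in P. ennreal (E x) = RN_deriv P (density P (\<lambda>x. ennreal (E x))) x"
    using E by (intro RN_deriv_unique) auto
  then have "AE x in P. entropy_density (exp 1) P (density P (\<lambda>x. ennreal (E x))) x = ln (E x)"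
    using AE_space
  proof eventually_elim
    case (elim x)
    then show ?case
      using E(2)[of x] by (simp add: entropy_density_def log_def elim(1)[symmetric])
  qed
  then show ?thesis
    using E by (intro absolutely_continuous_AE[OF _ absolutely_continuousI_density]) auto
qed

lemma relative_entropy_density:
  assumes "prob_space P" and "prob_space (density P (\<lambda>x. ennreal (D x)))"
    and D: "D \<in> borel_measurable P" "\<And>x. x \<in> space P \<Longrightarrow> 0 \<le> D x"
    and int: "integrable (density P (\<lambda>x. ennreal (D x))) (\<lambda>x. ln (D x))"
  shows "relative_entropy (density P (\<lambda>x. ennreal (D x))) P =
           ereal (LINT x|density P (\<lambda>x. ennreal (D x)). ln (D x))"
proof -
  interpret prob_space P by fact
  let ?Q = "density P (\<lambda>x. ennreal (D x))"
  have ae: "AE x in ?Q. entropy_density (exp 1) P ?Q x = ln (D x)"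
    using D by (intro entropy_density_density sigma_finite_measure_axioms)
  have m: "entropy_density (exp 1) P ?Q \<in> borel_measurable ?Q"
    by simp
  have "integrable ?Q (entropy_density (exp 1) P ?Q)"
    using integrable_cong_AE[OF m _ ae] int D by simp
  moreover have "absolutely_continuous P ?Q"
    using D by (intro absolutely_continuousI_density) auto
  moreover have "KL_divergence (exp 1) P ?Q = (LINT x|?Q. ln (D x))"
    unfolding KL_divergence_def using m D by (intro integral_cong_AE[OF _ _ ae]) auto
  ultimately show ?thesis
    by (simp add: relative_entropy_def)
qed

text \<open>Gibbs' inequality for an arbitrary absolutely continuous law; choosing a real-valued
  Radon-Nikodym derivative reduces it to the case of an explicit density.\<close>

lemma KL_divergence_nonneg_eq_0_iff:
  assumes "prob_space P" "prob_space Q" "absolutely_continuous P Q" "sets Q = sets P"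
    and int: "integrable Q (entropy_density (exp 1) P Q)"
  shows "0 \<le> KL_divergence (exp 1) P Q" "KL_divergence (exp 1) P Q = 0 \<longleftrightarrow> Q = P"
proof -
  interpret prob_space P by fact
  interpret information_space P "exp 1"
    by standard simp
  show "KL_divergence (exp 1) P Q = 0 \<longleftrightarrow> Q = P"
    by (rule KL_eq_0_iff_eq_ac) fact+
  interpret Q: prob_space Q by fact
  obtain D where D: "D \<in> borel_measurable P" "AE x in P. RN_deriv P Q x = ennreal (D x)"
      "AE x in Q. 0 < D x" "\<And>x. 0 \<le> D x"
    using real_RN_deriv[OF Q.finite_measure_axioms assms(3,4)] by blast
  have "Q = density P (RN_deriv P Q)"
    using assms by (simp add: density_RN_deriv)
  also have "\<dots> = density P D"
    using D by (intro density_cong) auto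
  finally have Q: "Q = density P D" .
  have ae: "AE x in Q. entropy_density (exp 1) P Q x = ln (D x)"
    by (rule entropy_density_density[OF sigma_finite_measure_axioms D(1,4), folded Q])
  have "entropy_density (exp 1) P Q \<in> borel_measurable Q" "(\<lambda>x. ln (D x)) \<in> borel_measurable Q"
    using D(1) by (auto simp: Q)
  from integrable_cong_AE[OF this ae] have "integrable Q (\<lambda>x. log (exp 1) (D x))"
    using int by (simp add: log_def)
  then have "integrable P (\<lambda>x. D x * log (exp 1) (D x))"
    using D by (simp add: Q integrable_real_density)
  then show "0 \<le> KL_divergence (exp 1) P Q"
    using D \<open>prob_space Q\<close> unfolding Q by (intro KL_nonneg) auto
qed

text \<open>The chain rule \<open>dQ/dP = dQ/dP' \<cdot> dP'/dP\<close> turns into a sum after taking logarithms;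
  here \<open>P'\<close> has \<open>P\<close>-density \<open>D\<close>.\<close>

lemma KL_divergence_change_reference:
  assumes "prob_space P" "prob_space Q" "absolutely_continuous P Q" "sets Q = sets P"
    and int: "integrable Q (entropy_density (exp 1) P Q)"
    and D: "D \<in> borel_measurable P" "\<And>x. 0 < D x"
    and intD: "integrable Q (\<lambda>x. ln (D x))"
  shows "absolutely_continuous (density P (\<lambda>x. ennreal (D x))) Q"
    and "integrable Q (entropy_density (exp 1) (density P (\<lambda>x. ennreal (D x))) Q)"
    and "KL_divergence (exp 1) P Q =
           KL_divergence (exp 1) (density P (\<lambda>x. ennreal (D x))) Q + (LINT x|Q. ln (D x))"
proof -
  interpret prob_space P by fact
  interpret Q: prob_space Q by fact
  let ?P' = "density P (\<lambda>x. ennreal (D x))"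
  obtain E where E: "E \<in> borel_measurable P" "AE x in P. RN_deriv P Q x = ennreal (E x)"
      "AE x in Q. 0 < E x" "\<And>x. 0 \<le> E x"
    using real_RN_deriv[OF Q.finite_measure_axioms assms(3,4)] by blast
  have "Q = density P (RN_deriv P Q)"
    using assms by (simp add: density_RN_deriv)
  also have "\<dots> = density P E"
    using E by (intro density_cong) auto
  finally have Q: "Q = density P E" .
  have "sigma_finite_measure ?P'"
    using D by (subst sigma_finite_iff_density_finite) auto
  have Q': "Q = density ?P' (\<lambda>x. ennreal (E x / D x))"
    using D E unfolding Q
    by (subst density_density_eq)
       (auto intro!: density_cong AE_I2 simp: ennreal_mult[symmetric] less_imp_le less_imp_neq[THEN not_sym])
  have ae: "AE x in Q. entropy_density (exp 1) P Q x = ln (E x)"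
    by (rule entropy_density_density[OF sigma_finite_measure_axioms E(1,4), folded Q])
  have "AE x in Q. entropy_density (exp 1) ?P' Q x = ln (E x / D x)"
    by (rule entropy_density_density[OF \<open>sigma_finite_measure ?P'\<close>, of "\<lambda>x. E x / D x", folded Q'])
       (use D E in \<open>auto intro!: divide_nonneg_pos\<close>)
  then have ae': "AE x in Q. entropy_density (exp 1) ?P' Q x = entropy_density (exp 1) P Q x - ln (D x)"
    using ae E(3) by eventually_elim (simp add: ln_div D(2) less_imp_neq[OF D(2), symmetric])
  show "absolutely_continuous ?P' Q"
    using D E by (subst Q', intro absolutely_continuousI_density) auto
  have m: "entropy_density (exp 1) ?P' Q \<in> borel_measurable Q"
    using measurable_entropy_density[of "exp 1" ?P' Q] assms(4) by (simp cong: measurable_cong_sets)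
  have "integrable Q (\<lambda>x. entropy_density (exp 1) P Q x - ln (D x))"
    using int intD by simp
  then show "integrable Q (entropy_density (exp 1) ?P' Q)"
    using integrable_cong_AE[OF m _ ae'] by simp
  have "KL_divergence (exp 1) ?P' Q = (LINT x|Q. entropy_density (exp 1) P Q x - ln (D x))"
    unfolding KL_divergence_def using m int intD by (intro integral_cong_AE[OF _ _ ae']) auto
  then show "KL_divergence (exp 1) P Q = KL_divergence (exp 1) ?P' Q + (LINT x|Q. ln (D x))"
    using int intD by (simp add: KL_divergence_def)
qed

definition partition_function :: "real \<Rightarrow> 'a measure \<Rightarrow> ('a \<Rightarrow> real) \<Rightarrow> real" where
  "partition_function \<beta> P g = (LINT x|P. exp (g x / \<beta>))"

text \<open>In statistical mechanics this is the Boltzmann distribution with energy \<open>-g\<close>, temperature \<open>\<beta>\<close>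
  and a priori law \<open>P\<close>.\<close>

definition gibbs_measure :: "real \<Rightarrow> 'a measure \<Rightarrow> ('a \<Rightarrow> real) \<Rightarrow> 'a measure" where
  "gibbs_measure \<beta> P g =
     density P (\<lambda>x. ennreal (exp (g x / \<beta>) / partition_function \<beta> P g))"

lemma integrable_bounded_exp:
  fixes g :: "'a \<Rightarrow> real"
  assumes "prob_space P" "g \<in> borel_measurable P" "bounded (g ` space P)" "0 < \<beta>"
  shows "integrable P (\<lambda>x. exp (g x / \<beta>))"
proof -
  interpret prob_space P by fact
  obtain b where b: "\<And>x. x \<in> space P \<Longrightarrow> \<bar>g x\<bar> \<le> b"
    using assms(3) by (auto simp: bounded_iff)
  have "norm (exp (g x / \<beta>)) \<le> exp (b / \<beta>)" if "x \<in> space P" for x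
    using b[OF that] \<open>0 < \<beta>\<close> by (simp add: divide_right_mono abs_le_iff)
  then show ?thesis
    using assms(2) by (intro integrable_const_bound[of _ "exp (b / \<beta>)"]) auto
qed

lemma partition_function_pos:
  assumes "prob_space P" "g \<in> borel_measurable P" "bounded (g ` space P)" "0 < \<beta>"
  shows "0 < partition_function \<beta> P g"
proof -
  interpret prob_space P by fact
  obtain b where b: "\<And>x. x \<in> space P \<Longrightarrow> \<bar>g x\<bar> \<le> b"
    using assms(3) by (auto simp: bounded_iff)
  have "exp (- b / \<beta>) \<le> exp (g x / \<beta>)" if "x \<in> space P" for x
    using b[OF that] \<open>0 < \<beta>\<close> unfolding exp_le_cancel_iff
    by (intro divide_right_mono) (auto simp: abs_le_iff)
  then have "(LINT x|P. exp (- b / \<beta>)) \<le> partition_function \<beta> P g"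
    unfolding partition_function_def
    by (intro integral_mono integrable_bounded_exp[OF assms]) auto
  then show ?thesis
    by (simp add: prob_space) (metis exp_gt_zero less_le_trans)
qed

lemma gibbs_measure_equivalent:
  assumes "prob_space P" "g \<in> borel_measurable P" "bounded (g ` space P)" "0 < \<beta>"
  shows "gibbs_measure \<beta> P g \<in> equivalent_laws P"
proof -
  interpret prob_space P by fact
  let ?Z = "partition_function \<beta> P g"
  have Z: "0 < ?Z"
    by (rule partition_function_pos[OF assms])
  have "emeasure (gibbs_measure \<beta> P g) (space P) = (\<integral>\<^sup>+x. ennreal (exp (g x / \<beta>) / ?Z) \<partial>P)"
    using assms(2) by (simp add: gibbs_measure_def emeasure_density cong: nn_integral_cong)
  also have "\<dots> = ennreal (LINT x|P. exp (g x / \<beta>) / ?Z)"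
    using Z integrable_bounded_exp[OF assms] by (intro nn_integral_eq_integral) auto
  also have "(LINT x|P. exp (g x / \<beta>) / ?Z) = 1"
    using Z by (simp add: partition_function_def)
  finally have "prob_space (gibbs_measure \<beta> P g)"
    by (intro prob_spaceI) (simp add: gibbs_measure_def)
  moreover have "absolutely_continuous (gibbs_measure \<beta> P g) P"
  proof -
    have "null_sets (gibbs_measure \<beta> P g) \<subseteq> null_sets P"
    proof
      fix A assume "A \<in> null_sets (gibbs_measure \<beta> P g)"
      then have "A \<in> sets P" "AE x in P. x \<notin> A"
        using assms(2) Z by (auto simp: gibbs_measure_def null_sets_density_iff ennreal_eq_0_iff not_le divide_le_0_iff)
      then show "A \<in> null_sets P"
        using AE_iff_null_sets by blast
    qed
    then show ?thesis by (simp add: absolutely_continuous_def)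
  qed
  moreover have "absolutely_continuous P (gibbs_measure \<beta> P g)"
    unfolding gibbs_measure_def using assms(2) by (intro absolutely_continuousI_density) auto
  ultimately show ?thesis
    by (simp add: equivalent_laws_def gibbs_measure_def)
qed

text \<open>The exact form of the variational principle: the distance from the optimal value is itself a
  relative entropy. It is the chain rule with the Gibbs measure as the intermediate law, whose
  logarithmic density is \<open>g/\<beta> - ln Z\<close>.\<close>

lemma gibbs_variational_identity:
  assumes "prob_space P" "g \<in> borel_measurable P" "bounded (g ` space P)" "0 < \<beta>"
    and "Q \<in> equivalent_laws P" "integrable Q (entropy_density (exp 1) P Q)"
  shows "absolutely_continuous (gibbs_measure \<beta> P g) Q"
    and "integrable Q (entropy_density (exp 1) (gibbs_measure \<beta> P g) Q)"
    and "(LINT x|Q. g x) - \<beta> * KL_divergence (exp 1) P Q =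
           \<beta> * ln (partition_function \<beta> P g) - \<beta> * KL_divergence (exp 1) (gibbs_measure \<beta> P g) Q"
proof -
  let ?Z = "partition_function \<beta> P g"
  have Z: "0 < ?Z"
    by (rule partition_function_pos[OF assms(1-4)])
  have Q: "prob_space Q" "absolutely_continuous P Q" "sets Q = sets P"
    using assms(5) by (auto simp: equivalent_laws_def)
  interpret Q: prob_space Q by fact
  have g: "g \<in> borel_measurable Q"
    using assms(2) Q(3) by (simp cong: measurable_cong_sets)
  obtain b where b: "\<And>x. x \<in> space P \<Longrightarrow> \<bar>g x\<bar> \<le> b"
    using assms(3) by (auto simp: bounded_iff)
  have intg: "integrable Q g"
    using b g sets_eq_imp_space_eq[OF Q(3)] by (intro Q.integrable_const_bound[of _ b]) auto
  have ln: "ln (exp (g x / \<beta>) / ?Z) = g x / \<beta> - ln ?Z" for x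
    using Z by (simp add: ln_div)
  have *: "(\<lambda>x. exp (g x / \<beta>) / ?Z) \<in> borel_measurable P" "0 < exp (g x / \<beta>) / ?Z"
    "integrable Q (\<lambda>x. ln (exp (g x / \<beta>) / ?Z))" for x
    unfolding ln using assms(2) Z intg by auto
  note ch = KL_divergence_change_reference[OF assms(1) Q assms(6) *]
  show "absolutely_continuous (gibbs_measure \<beta> P g) Q"
      "integrable Q (entropy_density (exp 1) (gibbs_measure \<beta> P g) Q)"
    using ch(1,2) by (simp_all add: gibbs_measure_def)
  have "(LINT x|Q. g x / \<beta> - ln ?Z) = (LINT x|Q. g x) / \<beta> - ln ?Z"
    using intg by (simp add: Q.prob_space)
  then have KL: "KL_divergence (exp 1) P Q =
      KL_divergence (exp 1) (gibbs_measure \<beta> P g) Q + ((LINT x|Q. g x) / \<beta> - ln ?Z)"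
    using ch(3) unfolding ln gibbs_measure_def[symmetric] by simp
  show "(LINT x|Q. g x) - \<beta> * KL_divergence (exp 1) P Q =
      \<beta> * ln ?Z - \<beta> * KL_divergence (exp 1) (gibbs_measure \<beta> P g) Q"
    unfolding KL using \<open>0 < \<beta>\<close> by (simp add: algebra_simps)
qed

text \<open>Laws of infinite entropy have objective \<open>-\<infinity>\<close>; for all others the identity above reduces the
  claim to nonnegativity of relative entropy and to its vanishing only at the reference law. The Gibbs
  measure has finite entropy, because its logarithmic density is bounded.\<close>

theorem gibbs_variational_principle:
  assumes "prob_space P" "g \<in> borel_measurable P" "bounded (g ` space P)" "0 < \<beta>"
    and "Q \<in> equivalent_laws P"
  shows "ereal (LINT x|Q. g x) - ereal \<beta> * relative_entropy Q P
           \<le> ereal (\<beta> * ln (partition_function \<beta> P g))" (is ?le)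
    and "ereal (LINT x|Q. g x) - ereal \<beta> * relative_entropy Q P
           = ereal (\<beta> * ln (partition_function \<beta> P g)) \<longleftrightarrow> Q = gibbs_measure \<beta> P g" (is ?iff)
proof -
  let ?G = "gibbs_measure \<beta> P g"
  interpret prob_space P by fact
  have G: "?G \<in> equivalent_laws P"
    by (rule gibbs_measure_equivalent[OF assms(1-4)])
  have Q: "prob_space Q" "absolutely_continuous P Q" "sets Q = sets P"
    using assms(5) by (auto simp: equivalent_laws_def)
  obtain b where b: "\<And>x. x \<in> space P \<Longrightarrow> \<bar>g x\<bar> \<le> b"
    using assms(3) by (auto simp: bounded_iff)
  have intG: "integrable ?G (entropy_density (exp 1) P ?G)"
  proof -
    let ?Z = "partition_function \<beta> P g"
    have Z: "0 < ?Z"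
      by (rule partition_function_pos[OF assms(1-4)])
    interpret G: prob_space ?G
      using G by (simp add: equivalent_laws_def)
    have ae: "AE x in ?G. entropy_density (exp 1) P ?G x = g x / \<beta> - ln ?Z"
      using entropy_density_density[OF sigma_finite_measure_axioms,
          of "\<lambda>x. exp (g x / \<beta>) / ?Z", folded gibbs_measure_def] assms(2) Z
      by (simp add: ln_div less_imp_le)
    have sp: "space ?G = space P"
      by (simp add: gibbs_measure_def)
    have "g \<in> borel_measurable ?G"
      using assms(2) by (simp add: gibbs_measure_def)
    then have "integrable ?G (\<lambda>x. g x / \<beta> - ln ?Z)"
      using b by (intro Bochner_Integration.integrable_diff integrable_divide
          G.integrable_const_bound[of g b]) (auto simp: sp)
    then show ?thesis
      by (subst integrable_cong_AE[OF _ _ ae]) (auto simp: gibbs_measure_def assms(2))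
  qed
  have "?le \<and> ?iff"
  proof (cases "integrable Q (entropy_density (exp 1) P Q)")
    case True
    note id = gibbs_variational_identity[OF assms True]
    have "prob_space ?G" "sets ?G = sets P"
      using G by (auto simp: equivalent_laws_def)
    note KL = KL_divergence_nonneg_eq_0_iff[OF this(1) Q(1) id(1) _ id(2)]
    have "relative_entropy Q P = ereal (KL_divergence (exp 1) P Q)"
      using True Q by (simp add: relative_entropy_def)
    then show ?thesis
      using KL id(3) \<open>sets ?G = sets P\<close> Q(3) \<open>0 < \<beta>\<close> by auto
  next
    case False
    then have "relative_entropy Q P = \<infinity>"
      by (simp add: relative_entropy_def)
    moreover have "Q \<noteq> ?G"
      using False intG by auto
    ultimately show ?thesis
      using \<open>0 < \<beta>\<close> by simp
  qed
  then show ?le ?iff by auto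
qed

text \<open>A reward that factors through \<open>X\<close> leaves the conditional law given \<open>X\<close> unchanged, so that
  tilting commutes with taking the image under \<open>X\<close>. This is used twice: for the terminal value of a
  path, and for the passage from ranks to states by a quantile function.\<close>

lemma gibbs_measure_distr:
  assumes X: "X \<in> measurable P N" and h: "h \<in> borel_measurable N"
  shows "partition_function \<beta> (distr P N X) h = partition_function \<beta> P (\<lambda>\<omega>. h (X \<omega>))"
    and "gibbs_measure \<beta> (distr P N X) h = distr (gibbs_measure \<beta> P (\<lambda>\<omega>. h (X \<omega>))) N X"
proof -
  show eq: "partition_function \<beta> (distr P N X) h = partition_function \<beta> P (\<lambda>\<omega>. h (X \<omega>))"
    unfolding partition_function_def using h by (subst integral_distr[OF X]) auto
  show "gibbs_measure \<beta> (distr P N X) h = distr (gibbs_measure \<beta> P (\<lambda>\<omega>. h (X \<omega>))) N X"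
    unfolding gibbs_measure_def eq using h by (subst density_distr[OF _ X]) auto
qed

lemma gibbs_measure_cong:
  assumes "g \<in> borel_measurable P" "\<And>x. x \<in> space P \<Longrightarrow> g x = h x"
  shows "gibbs_measure \<beta> P g = gibbs_measure \<beta> P h"
proof -
  have "partition_function \<beta> P g = partition_function \<beta> P h"
    unfolding partition_function_def using assms by (intro Bochner_Integration.integral_cong) auto
  then show ?thesis
    unfolding gibbs_measure_def using assms measurable_cong[of P g h borel]
    by (intro density_cong) auto
qed

text \<open>The normalizing constant is forced by total mass one. This identifies a Gibbs measure, and its
  partition function, from a density known up to a factor.\<close>

lemma density_eq_gibbs_measure:
  assumes "prob_space P" "g \<in> borel_measurable P" "bounded (g ` space P)" "0 < \<beta>" "0 < k"
    and "prob_space (density P (\<lambda>x. ennreal (k * exp (g x / \<beta>))))"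
  shows "k * partition_function \<beta> P g = 1"
    and "density P (\<lambda>x. ennreal (k * exp (g x / \<beta>))) = gibbs_measure \<beta> P g"
proof -
  interpret D: prob_space "density P (\<lambda>x. ennreal (k * exp (g x / \<beta>)))" by fact
  have "1 = emeasure (density P (\<lambda>x. ennreal (k * exp (g x / \<beta>)))) (space P)"
    using D.emeasure_space_1 by simp
  also have "\<dots> = (\<integral>\<^sup>+x. ennreal (k * exp (g x / \<beta>)) \<partial>P)"
    using assms(2) by (simp add: emeasure_density cong: nn_integral_cong)
  also have "\<dots> = ennreal (LINT x|P. k * exp (g x / \<beta>))"
    using assms(5) integrable_bounded_exp[OF assms(1-4)] by (intro nn_integral_eq_integral) auto
  finally have "ennreal (LINT x|P. k * exp (g x / \<beta>)) = 1"
    by (rule sym)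
  then show k: "k * partition_function \<beta> P g = 1"
    by (simp add: partition_function_def)
  then have "partition_function \<beta> P g = 1 / k"
    using assms(5) by (simp add: field_simps)
  then show "density P (\<lambda>x. ennreal (k * exp (g x / \<beta>))) = gibbs_measure \<beta> P g"
    by (simp add: gibbs_measure_def mult.commute)
qed

text \<open>This symmetry makes the equilibrium problem explicit: the unknown law, rather than the given
  one, becomes the measure being tilted.\<close>

lemma gibbs_measure_inverse:
  assumes "prob_space P" "g \<in> borel_measurable P" "bounded (g ` space P)" "0 < \<beta>"
  shows "gibbs_measure \<beta> (gibbs_measure \<beta> P g) (\<lambda>x. - g x) = P"
proof -
  let ?Z = "partition_function \<beta> P g" and ?G = "gibbs_measure \<beta> P g"
  have Z: "0 < ?Z"
    by (rule partition_function_pos[OF assms])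
  have "density ?G (\<lambda>x. ennreal (?Z * exp (- g x / \<beta>))) =
      density P (\<lambda>x. ennreal (exp (g x / \<beta>) / ?Z) * ennreal (?Z * exp (- g x / \<beta>)))"
    unfolding gibbs_measure_def using assms(2) by (subst density_density_eq) auto
  also have "\<dots> = density P (\<lambda>_. 1)"
    using Z by (simp add: ennreal_mult[symmetric] exp_minus)
  finally have P: "density ?G (\<lambda>x. ennreal (?Z * exp (- g x / \<beta>))) = P"
    by (simp add: density_1)
  have "prob_space ?G"
    using gibbs_measure_equivalent[OF assms] by (simp add: equivalent_laws_def)
  then have "density ?G (\<lambda>x. ennreal (?Z * exp (- g x / \<beta>))) = gibbs_measure \<beta> ?G (\<lambda>x. - g x)"
    using assms Z P by (intro density_eq_gibbs_measure) (auto simp: gibbs_measure_def bounded_iff)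
  with P show ?thesis by simp
qed

section \<open>Best responses depend on the terminal law only\<close>

lemma terminal_value_measurable:
  assumes "0 < T"
  shows "(\<lambda>\<omega>. \<omega> T) \<in> measurable (path_space T) borel"
  unfolding path_space_def using assms
  by (intro measurable_restrict_space1 measurable_component_singleton) auto

lemma reference_law_terminal:
  assumes "0 < T" "0 < \<sigma>" and B: "standard_brownian_motion T M B"
  shows "prob_space (reference_law T \<sigma> x0 M B)"
    and "sets (reference_law T \<sigma> x0 M B) = sets (path_space T)"
    and "terminal_law T (reference_law T \<sigma> x0 M B) = density lborel (ref_density T \<sigma> x0)"
proof -
  interpret prob_space M
    using B by (simp add: standard_brownian_motion_def)
  have Bm: "B t \<in> borel_measurable M" if "t \<in> {0..T}" for t
    using B that by (simp add: standard_brownian_motion_def)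
  have B0: "B 0 w = 0" and Bc: "continuous_on {0..T} (\<lambda>t. B t w)" if "w \<in> space M" for w
    using B that by (simp_all add: standard_brownian_motion_def)
  have Bd: "distributed M lborel (\<lambda>w. B T w - B 0 w) (normal_density 0 (sqrt (T - 0)))"
    using B \<open>0 < T\<close> unfolding standard_brownian_motion_def by (meson order_refl)
  let ?X = "\<lambda>w. \<lambda>t\<in>{0..T}. x0 + \<sigma> * B t w"
  have "?X \<in> measurable M (\<Pi>\<^sub>M t\<in>{0..T}. borel)"
    using Bm by (intro measurable_restrict borel_measurable_add borel_measurable_times) auto
  moreover have "continuous_on {0..T} (?X w)" if "w \<in> space M" for w
  proof -
    have "continuous_on {0..T} (\<lambda>t. x0 + \<sigma> * B t w)"
      by (intro continuous_intros Bc[OF that])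
    then show ?thesis
      by (rule continuous_on_eq) auto
  qed
  ultimately have X: "?X \<in> measurable M (path_space T)"
    unfolding path_space_def by (intro measurable_restrict_space2) auto
  show "prob_space (reference_law T \<sigma> x0 M B)"
    unfolding reference_law_def using X by (rule prob_space_distr)
  show "sets (reference_law T \<sigma> x0 M B) = sets (path_space T)"
    by (simp add: reference_law_def)
  from Bd have "distributed M lborel (\<lambda>w. x0 + \<sigma> * (B T w - B 0 w)) (normal_density (x0 + \<sigma> * 0) (\<bar>\<sigma>\<bar> * sqrt (T - 0)))"
    using \<open>0 < T\<close> \<open>0 < \<sigma>\<close> by (intro normal_density_affine) auto
  then have "density lborel (ref_density T \<sigma> x0) = distr M lborel (\<lambda>w. x0 + \<sigma> * (B T w - B 0 w))"
    using \<open>0 < \<sigma>\<close> by (simp add: distributed_def ref_density_def)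
  also have "\<dots> = distr M borel (\<lambda>w. ?X w T)"
    using B0 \<open>0 < T\<close> by (intro distr_cong) auto
  also have "\<dots> = terminal_law T (reference_law T \<sigma> x0 M B)"
    unfolding terminal_law_def reference_law_def
    using X terminal_value_measurable[OF \<open>0 < T\<close>] by (simp add: distr_distr comp_def)
  finally show "terminal_law T (reference_law T \<sigma> x0 M B) = density lborel (ref_density T \<sigma> x0)"
    by simp
qed

lemma rank_reward_of_cdf:
  assumes "R \<in> rank_rewards" "real_distribution \<mu>"
  shows "mono (\<lambda>x. R (cdf \<mu> x))"
    and "(\<lambda>x. R (cdf \<mu> x)) \<in> borel_measurable borel"
    and "bounded (range (\<lambda>x. R (cdf \<mu> x)))"
proof -
  interpret real_distribution \<mu> by fact
  have F: "cdf \<mu> x \<in> {0..1}" for x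
    by (simp add: cdf_nonneg cdf_bounded_prob)
  show "mono (\<lambda>x. R (cdf \<mu> x))"
    using assms(1) F by (auto simp: rank_rewards_def intro!: monoI mono_onD[of "{0..1}" R] cdf_nondecreasing)
  then show "(\<lambda>x. R (cdf \<mu> x)) \<in> borel_measurable borel"
    by (rule borel_measurable_mono)
  show "bounded (range (\<lambda>x. R (cdf \<mu> x)))"
  proof (rule bounded_subset)
    show "bounded (R ` {0..1})"
      using assms(1) by (simp add: rank_rewards_def)
    show "range (\<lambda>x. R (cdf \<mu> x)) \<subseteq> R ` {0..1}"
      using F by blast
  qed
qed

text \<open>An equilibrium depends on the optimal \<open>Q\<close> only through its terminal law. Since the
  optimal \<open>Q\<close> is unique, being an equilibrium is an equation for \<open>\<mu>\<close> alone.\<close>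

lemma best_response:
  fixes c \<sigma> :: real
  defines "\<beta> \<equiv> 2 * c * \<sigma>\<^sup>2"
  assumes "0 < T" "0 < \<sigma>" "0 < c" "prob_space P" "sets P = sets (path_space T)"
    and "R \<in> rank_rewards" "real_distribution \<mu>"
  shows "best_response_value T \<sigma> c P R \<mu> =
           ereal (\<beta> * ln (partition_function \<beta> (terminal_law T P) (\<lambda>x. R (cdf \<mu> x))))"
    and "(\<exists>Q\<in>equivalent_laws P. \<mu> = terminal_law T Q \<and>
            objective T \<sigma> c P R \<mu> Q = best_response_value T \<sigma> c P R \<mu>) \<longleftrightarrow>
          \<mu> = gibbs_measure \<beta> (terminal_law T P) (\<lambda>x. R (cdf \<mu> x))"
proof -
  let ?h = "\<lambda>x. R (cdf \<mu> x)"
  let ?g = "\<lambda>\<omega>. ?h (\<omega> T)"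
  note h = rank_reward_of_cdf[OF assms(7,8)]
  have "0 < \<beta>"
    using assms by simp
  have X: "(\<lambda>\<omega>. \<omega> T) \<in> measurable P borel"
    using terminal_value_measurable[OF assms(2)] assms(6) by (simp cong: measurable_cong_sets)
  have g: "?g \<in> borel_measurable P"
    by (rule measurable_compose[OF X h(2)])
  have b: "bounded (?g ` space P)"
    by (rule bounded_subset[OF h(3)]) auto
  note vp = gibbs_variational_principle[OF assms(5) g b \<open>0 < \<beta>\<close>]
  have obj: "objective T \<sigma> c P R \<mu> Q = ereal (LINT \<omega>|Q. ?g \<omega>) - ereal \<beta> * relative_entropy Q P" for Q
    by (simp add: objective_def \<beta>_def)
  have G: "gibbs_measure \<beta> P ?g \<in> equivalent_laws P"
    by (rule gibbs_measure_equivalent[OF assms(5) g b \<open>0 < \<beta>\<close>])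
  have val: "best_response_value T \<sigma> c P R \<mu> = ereal (\<beta> * ln (partition_function \<beta> P ?g))"
    unfolding best_response_value_def
  proof (rule antisym)
    show "(SUP Q\<in>equivalent_laws P. objective T \<sigma> c P R \<mu> Q) \<le> ereal (\<beta> * ln (partition_function \<beta> P ?g))"
      unfolding obj by (intro SUP_least vp)
    show "ereal (\<beta> * ln (partition_function \<beta> P ?g)) \<le> (SUP Q\<in>equivalent_laws P. objective T \<sigma> c P R \<mu> Q)"
      using vp(2)[OF G] by (intro SUP_upper2[OF G]) (simp add: obj)
  qed
  note gibbs = gibbs_measure_distr[OF X h(2), of \<beta>, folded terminal_law_def]
  show "best_response_value T \<sigma> c P R \<mu> =
      ereal (\<beta> * ln (partition_function \<beta> (terminal_law T P) ?h))"
    using val by (simp add: gibbs(1))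
  have "(\<exists>Q\<in>equivalent_laws P. \<mu> = terminal_law T Q \<and>
            objective T \<sigma> c P R \<mu> Q = best_response_value T \<sigma> c P R \<mu>) \<longleftrightarrow>
        \<mu> = terminal_law T (gibbs_measure \<beta> P ?g)"
  proof
    assume "\<exists>Q\<in>equivalent_laws P. \<mu> = terminal_law T Q \<and>
        objective T \<sigma> c P R \<mu> Q = best_response_value T \<sigma> c P R \<mu>"
    then obtain Q where Q: "Q \<in> equivalent_laws P" "\<mu> = terminal_law T Q"
        "objective T \<sigma> c P R \<mu> Q = best_response_value T \<sigma> c P R \<mu>"
      by blast
    from Q(3) have "Q = gibbs_measure \<beta> P ?g"
      unfolding val obj vp(2)[OF Q(1)] .
    with Q(2) show "\<mu> = terminal_law T (gibbs_measure \<beta> P ?g)"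
      by simp
  next
    assume "\<mu> = terminal_law T (gibbs_measure \<beta> P ?g)"
    moreover have "objective T \<sigma> c P R \<mu> (gibbs_measure \<beta> P ?g) = best_response_value T \<sigma> c P R \<mu>"
      unfolding val obj vp(2)[OF G] ..
    ultimately show "\<exists>Q\<in>equivalent_laws P. \<mu> = terminal_law T Q \<and>
        objective T \<sigma> c P R \<mu> Q = best_response_value T \<sigma> c P R \<mu>"
      using G by (intro bexI[of _ "gibbs_measure \<beta> P ?g"] conjI)
  qed
  then show "(\<exists>Q\<in>equivalent_laws P. \<mu> = terminal_law T Q \<and>
            objective T \<sigma> c P R \<mu> Q = best_response_value T \<sigma> c P R \<mu>) \<longleftrightarrow>
          \<mu> = gibbs_measure \<beta> (terminal_law T P) ?h"
    by (simp add: gibbs(2))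
qed

lemma terminal_law_real_distribution:
  assumes "0 < T" "prob_space Q" "sets Q = sets (path_space T)"
  shows "real_distribution (terminal_law T Q)"
proof -
  interpret prob_space Q by fact
  show ?thesis
    unfolding terminal_law_def
    using terminal_value_measurable[OF assms(1)] assms(3)
    by (intro real_distribution_distr) (simp cong: measurable_cong_sets)
qed

lemma is_equilibrium_iff_gibbs_measure:
  fixes c \<sigma> :: real
  assumes "0 < T" "0 < \<sigma>" "0 < c" "prob_space P" "sets P = sets (path_space T)"
    and "R \<in> rank_rewards"
  shows "is_equilibrium T \<sigma> c P R \<mu> \<longleftrightarrow>
           real_distribution \<mu> \<and>
           \<mu> = gibbs_measure (2 * c * \<sigma>\<^sup>2) (terminal_law T P) (\<lambda>x. R (cdf \<mu> x))"
proof (cases "real_distribution \<mu>")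
  case True
  show ?thesis
    unfolding is_equilibrium_def using True best_response(2)[OF assms True] by simp
next
  case False
  have "real_distribution (terminal_law T Q)" if "Q \<in> equivalent_laws P" for Q
    using that assms(5) by (intro terminal_law_real_distribution assms) (auto simp: equivalent_laws_def)
  with False show ?thesis
    by (auto simp: is_equilibrium_def)
qed

section \<open>Quantile functions of atomless laws\<close>

abbreviation uniform_law :: "real measure" where
  "uniform_law \<equiv> restrict_space lborel {0<..<1}"

lemma prob_space_uniform_law: "prob_space uniform_law"
  by (auto simp: emeasure_restrict_space space_restrict_space intro!: prob_spaceI)

lemma quantile_le_iff:
  assumes "real_distribution \<mu>" "0 < r" "r < 1"
  shows "quantile \<mu> r \<le> x \<longleftrightarrow> r \<le> cdf \<mu> x"
proof -
  interpret cdf_distribution \<mu>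
    using assms(1) by (simp add: cdf_distribution_def)
  show ?thesis
    unfolding quantile_def by (rule pseudoinverse[OF assms(2,3), symmetric])
qed

lemma quantile_measurable:
  assumes "real_distribution \<mu>"
  shows "quantile \<mu> \<in> borel_measurable (restrict_space borel {0<..<1})"
    and "quantile \<mu> \<in> borel_measurable uniform_law"
proof -
  interpret cdf_distribution \<mu>
    using assms(1) by (simp add: cdf_distribution_def)
  show "quantile \<mu> \<in> borel_measurable (restrict_space borel {0<..<1})"
    using measurable_CI by (simp add: quantile_def[abs_def])
  then show "quantile \<mu> \<in> borel_measurable uniform_law"
    by (subst measurable_cong_sets[OF sets_restrict_space_cong[OF sets_lborel] refl])
qed

lemma distr_quantile:
  assumes "real_distribution \<mu>"
  shows "distr uniform_law borel (quantile \<mu>) = \<mu>"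
proof -
  interpret cdf_distribution \<mu>
    using assms(1) by (simp add: cdf_distribution_def)
  show ?thesis
    using distr_I_eq_M by (simp add: quantile_def[abs_def])
qed

text \<open>If the c.d.f. exceeded \<open>r\<close> at the quantile, by continuity it would do so slightly to the left,
  against minimality of the quantile.\<close>

lemma cdf_quantile:
  assumes \<mu>: "real_distribution \<mu>" "\<And>x. measure \<mu> {x} = 0" and r: "0 < r" "r < 1"
  shows "cdf \<mu> (quantile \<mu> r) = r"
proof (rule antisym)
  interpret real_distribution \<mu> by fact
  show "r \<le> cdf \<mu> (quantile \<mu> r)"
    using quantile_le_iff[OF \<mu>(1) r] by blast
  show "cdf \<mu> (quantile \<mu> r) \<le> r"
  proof (rule ccontr)
    assume *: "\<not> cdf \<mu> (quantile \<mu> r) \<le> r"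
    have "isCont (cdf \<mu>) (quantile \<mu> r)"
      using \<mu>(2) by (simp add: isCont_cdf)
    then have "(cdf \<mu> \<longlongrightarrow> cdf \<mu> (quantile \<mu> r)) (at_left (quantile \<mu> r))"
      by (simp add: isCont_def filterlim_at_split)
    then have "\<forall>\<^sub>F x in at_left (quantile \<mu> r). r < cdf \<mu> x"
      by (rule order_tendstoD(1)) (use * in simp)
    then have "\<forall>\<^sub>F x in at_left (quantile \<mu> r). r < cdf \<mu> x \<and> x \<in> {quantile \<mu> r - 1<..<quantile \<mu> r}"
      by (rule eventually_conj) (rule eventually_at_left_real, simp)
    then obtain x where "r < cdf \<mu> x" "x < quantile \<mu> r"
      using eventually_happens'[OF trivial_limit_at_left_real] by fastforce
    then show False
      using quantile_le_iff[OF \<mu>(1) r, of x] by simp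
  qed
qed

lemma AE_quantile_iff:
  assumes "real_distribution \<mu>" "{x. \<phi> x} \<in> sets borel"
  shows "(AE x in \<mu>. \<phi> x) \<longleftrightarrow> (AE r in uniform_law. \<phi> (quantile \<mu> r))"
proof -
  have "(AE x in distr uniform_law borel (quantile \<mu>). \<phi> x) \<longleftrightarrow> (AE r in uniform_law. \<phi> (quantile \<mu> r))"
    using assms quantile_measurable[OF assms(1)] by (intro AE_distr_iff) auto
  then show ?thesis
    unfolding distr_quantile[OF assms(1)] .
qed

section \<open>Existence and uniqueness of the equilibrium\<close>

lemma rank_reward_on_uniform_law:
  assumes "R \<in> rank_rewards"
  shows "R \<in> borel_measurable uniform_law" "bounded (R ` space uniform_law)"
proof -
  have "mono_on {0<..<1} R"
    using assms by (auto simp: rank_rewards_def intro: mono_on_subset)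
  then have "R \<in> borel_measurable (restrict_space borel {0<..<1})"
    by (rule borel_measurable_mono_on_fnc)
  then show "R \<in> borel_measurable uniform_law"
    by (subst measurable_cong_sets[OF sets_restrict_space_cong[OF sets_lborel] refl])
  show "bounded (R ` space uniform_law)"
  proof (rule bounded_subset)
    show "bounded (R ` {0..1})"
      using assms(1) by (simp add: rank_rewards_def)
    show "R ` space uniform_law \<subseteq> R ` {0..1}"
      by (intro image_mono) (auto simp: space_restrict_space)
  qed
qed

text \<open>Proportional to \<open>exp (-R/\<beta>)\<close> on \<open>(0,1)\<close>: the form that the terminal reference law takes
  in rank coordinates when it is recovered from the equilibrium for \<open>R\<close> by inverse tilting.\<close>

definition rank_tilt :: "real \<Rightarrow> (real \<Rightarrow> real) \<Rightarrow> real measure" where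
  "rank_tilt \<beta> R = gibbs_measure \<beta> uniform_law (\<lambda>r. - R r)"

lemma rank_tilt_equivalent:
  assumes "R \<in> rank_rewards" "0 < \<beta>"
  shows "rank_tilt \<beta> R \<in> equivalent_laws uniform_law"
  unfolding rank_tilt_def using rank_reward_on_uniform_law[OF assms(1)] assms(2)
  by (intro gibbs_measure_equivalent prob_space_uniform_law) (auto simp: bounded_iff)

definition tilted_rank :: "real \<Rightarrow> (real \<Rightarrow> real) \<Rightarrow> real \<Rightarrow> real" where
  "tilted_rank \<beta> R = cdf (distr (rank_tilt \<beta> R) borel (\<lambda>r. r))"

lemma measurable_rank_tilt:
  assumes "f \<in> measurable uniform_law N"
  shows "f \<in> measurable (rank_tilt \<beta> R) N"
  using assms by (simp add: rank_tilt_def gibbs_measure_def)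

lemma space_rank_tilt: "space (rank_tilt \<beta> R) = {0<..<1}"
  by (simp add: rank_tilt_def gibbs_measure_def space_restrict_space)

lemma measurable_ident_uniform_law: "(\<lambda>r. r) \<in> borel_measurable uniform_law"
  by (intro measurable_restrict_space1) simp

text \<open>The tilted law and the uniform law have the same null sets. Points are null, which
  gives continuity, and intervals inside \<open>[0,1]\<close> are not, which gives strict monotonicity.\<close>

lemma tilted_rank_cdf:
  assumes "R \<in> rank_rewards" "0 < \<beta>"
  shows "\<And>a. tilted_rank \<beta> R a = measure (rank_tilt \<beta> R) {r \<in> {0<..<1}. r \<le> a}"
    and "tilted_rank \<beta> R 0 = 0" "tilted_rank \<beta> R 1 = 1"
    and "\<And>x. isCont (tilted_rank \<beta> R) x"
    and "strict_mono_on {0..1} (tilted_rank \<beta> R)"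
proof -
  have eq: "prob_space (rank_tilt \<beta> R)" "sets (rank_tilt \<beta> R) = sets uniform_law"
    "absolutely_continuous uniform_law (rank_tilt \<beta> R)" "absolutely_continuous (rank_tilt \<beta> R) uniform_law"
    using rank_tilt_equivalent[OF assms] by (auto simp: equivalent_laws_def)
  interpret V: prob_space "rank_tilt \<beta> R" by fact
  let ?D = "distr (rank_tilt \<beta> R) borel (\<lambda>r. r)"
  have id: "(\<lambda>r. r) \<in> borel_measurable (rank_tilt \<beta> R)"
    by (intro measurable_rank_tilt measurable_ident_uniform_law)
  have D: "real_distribution ?D"
    using id by (rule V.real_distribution_distr)
  interpret D: real_distribution ?D by fact
  have meas: "measure ?D A = measure (rank_tilt \<beta> R) (A \<inter> {0<..<1})" if "A \<in> sets borel" for A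
    using that id by (simp add: measure_distr space_rank_tilt)
  show F: "tilted_rank \<beta> R a = measure (rank_tilt \<beta> R) {r \<in> {0<..<1}. r \<le> a}" for a
    by (simp add: tilted_rank_def cdf_def meas Int_def conj_commute)
  have "{r \<in> {0<..<1}. r \<le> (0::real)} = {}" "{r \<in> {0<..<1}. r \<le> (1::real)} = space (rank_tilt \<beta> R)"
    by (auto simp: space_rank_tilt)
  then show "tilted_rank \<beta> R 0 = 0" "tilted_rank \<beta> R 1 = 1"
    by (simp_all only: F V.prob_space measure_empty)
  have null: "measure (rank_tilt \<beta> R) (A \<inter> {0<..<1}) = 0 \<longleftrightarrow> emeasure lborel (A \<inter> {0<..<1}) = 0"
    if "A \<in> sets borel" for A
  proof -
    have A: "A \<inter> {0<..<1} \<in> sets uniform_law"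
      using that by (auto simp: sets_restrict_space)
    then have "measure (rank_tilt \<beta> R) (A \<inter> {0<..<1}) = 0 \<longleftrightarrow> A \<inter> {0<..<1} \<in> null_sets (rank_tilt \<beta> R)"
      using eq(2) by (simp add: V.emeasure_eq_measure null_sets_def)
    also have "\<dots> \<longleftrightarrow> A \<inter> {0<..<1} \<in> null_sets uniform_law"
      using eq(3,4) by (auto simp: absolutely_continuous_def)
    also have "\<dots> \<longleftrightarrow> emeasure lborel (A \<inter> {0<..<1}) = 0"
      using A by (simp add: null_sets_def emeasure_restrict_space)
    finally show ?thesis .
  qed
  show "isCont (tilted_rank \<beta> R) x" for x
  proof -
    have "emeasure lborel ({x} \<inter> {0<..<1}) \<le> emeasure lborel {x}"
      by (intro emeasure_mono) auto
    then have "measure ?D {x} = 0"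
      using meas[of "{x}"] null[of "{x}"] by simp
    then show ?thesis
      unfolding tilted_rank_def by (simp add: D.isCont_cdf)
  qed
  show "strict_mono_on {0..1} (tilted_rank \<beta> R)"
  proof (rule strict_mono_onI)
    fix a b :: real
    assume ab: "a \<in> {0..1}" "b \<in> {0..1}" "a < b"
    have "emeasure lborel {a<..<b} \<le> emeasure lborel ({a<..b} \<inter> {0<..<1})"
      using ab by (intro emeasure_mono) auto
    then have "emeasure lborel ({a<..b} \<inter> {0<..<1}) \<noteq> 0"
      using ab by auto
    then have "measure ?D {a<..b} \<noteq> 0"
      using meas[of "{a<..b}"] null[of "{a<..b}"] by simp
    then have "0 < measure ?D {a<..b}"
      using measure_nonneg[of ?D "{a<..b}"] by linarith
    then show "tilted_rank \<beta> R a < tilted_rank \<beta> R b"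
      using D.cdf_diff_eq[OF \<open>a < b\<close>] by (simp add: tilted_rank_def)
  qed
qed

text \<open>Tilting commutes with the quantile map, and the reward \<open>R \<circ> F\<^sub>\<mu>\<close> pulled back by the
  quantile map is \<open>R\<close> itself.\<close>

lemma distr_rank_tilt_quantile:
  assumes "R \<in> rank_rewards" "0 < \<beta>" "real_distribution \<mu>" "\<And>x. measure \<mu> {x} = 0"
  shows "distr (rank_tilt \<beta> R) borel (quantile \<mu>) = gibbs_measure \<beta> \<mu> (\<lambda>x. - R (cdf \<mu> x))"
proof -
  have h: "(\<lambda>x. - R (cdf \<mu> x)) \<in> borel_measurable borel"
    using rank_reward_of_cdf(2)[OF assms(1,3)] by simp
  have "gibbs_measure \<beta> \<mu> (\<lambda>x. - R (cdf \<mu> x)) =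
      gibbs_measure \<beta> (distr uniform_law borel (quantile \<mu>)) (\<lambda>x. - R (cdf \<mu> x))"
    by (simp only: distr_quantile[OF assms(3)])
  also have "\<dots> = distr (gibbs_measure \<beta> uniform_law (\<lambda>r. - R (cdf \<mu> (quantile \<mu> r)))) borel (quantile \<mu>)"
    by (rule gibbs_measure_distr(2)[OF quantile_measurable(2)[OF assms(3)] h])
  also have "gibbs_measure \<beta> uniform_law (\<lambda>r. - R (cdf \<mu> (quantile \<mu> r))) = rank_tilt \<beta> R"
    unfolding rank_tilt_def using measurable_compose[OF quantile_measurable(2)[OF assms(3)] h]
    by (intro gibbs_measure_cong) (auto simp: space_restrict_space cdf_quantile[OF assms(3,4)])
  finally show ?thesis ..
qed

text \<open>On the left \<open>\<mu>\<close> occurs both as the law and inside the reward. On the right this has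
  become a pointwise equation for its c.d.f.: by inverse tilting, the left side says that the quantile map
  of \<open>\<mu>\<close> carries the tilted rank law to \<open>N\<close>, and one compares c.d.f.s using
  \<open>q\<^sub>\<mu> r \<le> x \<longleftrightarrow> r \<le> F\<^sub>\<mu> x\<close>.\<close>

lemma gibbs_fixed_point_iff:
  assumes R: "R \<in> rank_rewards" "0 < \<beta>"
    and N: "real_distribution N" and \<mu>: "real_distribution \<mu>" "\<And>x. measure \<mu> {x} = 0"
  shows "\<mu> = gibbs_measure \<beta> N (\<lambda>x. R (cdf \<mu> x)) \<longleftrightarrow> (\<forall>x. tilted_rank \<beta> R (cdf \<mu> x) = cdf N x)"
proof -
  interpret N: real_distribution N by fact
  interpret \<mu>: real_distribution \<mu> by fact
  have h: "(\<lambda>x. R (cdf \<mu> x)) \<in> borel_measurable borel" "bounded (range (\<lambda>x. R (cdf \<mu> x)))"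
    using rank_reward_of_cdf[OF R(1) \<mu>(1)] by auto
  interpret V: prob_space "rank_tilt \<beta> R"
    using rank_tilt_equivalent[OF R] by (simp add: equivalent_laws_def)
  let ?D = "distr (rank_tilt \<beta> R) borel (quantile \<mu>)"
  have q: "quantile \<mu> \<in> borel_measurable (rank_tilt \<beta> R)"
    by (intro measurable_rank_tilt quantile_measurable \<mu>)
  have "\<mu> = gibbs_measure \<beta> N (\<lambda>x. R (cdf \<mu> x)) \<longleftrightarrow> ?D = N"
  proof
    assume *: "\<mu> = gibbs_measure \<beta> N (\<lambda>x. R (cdf \<mu> x))"
    have "gibbs_measure \<beta> (gibbs_measure \<beta> N (\<lambda>x. R (cdf \<mu> x))) (\<lambda>x. - R (cdf \<mu> x)) = N"
      using h R(2) by (intro gibbs_measure_inverse N.prob_space_axioms) auto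
    then show "?D = N"
      unfolding *[symmetric] distr_rank_tilt_quantile[OF R \<mu>] .
  next
    assume *: "?D = N"
    have "gibbs_measure \<beta> (gibbs_measure \<beta> \<mu> (\<lambda>x. - R (cdf \<mu> x))) (\<lambda>x. - (- R (cdf \<mu> x))) = \<mu>"
      using h R(2) by (intro gibbs_measure_inverse \<mu>.prob_space_axioms) (auto simp: bounded_iff)
    then show "\<mu> = gibbs_measure \<beta> N (\<lambda>x. R (cdf \<mu> x))"
      unfolding *[symmetric] distr_rank_tilt_quantile[OF R \<mu>] by simp
  qed
  also have "\<dots> \<longleftrightarrow> cdf ?D = cdf N"
    using cdf_unique[OF V.real_distribution_distr[OF q] N] by auto
  also have "cdf ?D x = tilted_rank \<beta> R (cdf \<mu> x)" for x
  proof -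
    have "quantile \<mu> -` {..x} \<inter> {0<..<1} = {r \<in> {0<..<1}. r \<le> cdf \<mu> x}"
      by (auto simp: quantile_le_iff[OF \<mu>(1)])
    then show ?thesis
      using q by (simp add: cdf_def measure_distr space_rank_tilt tilted_rank_cdf(1)[OF R])
  qed
  then have "cdf ?D = cdf N \<longleftrightarrow> (\<forall>x. tilted_rank \<beta> R (cdf \<mu> x) = cdf N x)"
    by (auto simp: fun_eq_iff)
  finally show ?thesis .
qed

lemma density_atomless:
  assumes "f \<in> borel_measurable N" "{x} \<in> null_sets N"
  shows "measure (density N f) {x} = 0"
proof (rule measure_eq_0_null_sets)
  show "{x} \<in> null_sets (density N f)"
    using absolutely_continuousI_density[OF assms(1)] assms(2) unfolding absolutely_continuous_def
    by (rule subsetD)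
qed

lemma real_distribution_null_singleton:
  assumes "real_distribution N" "measure N {x} = 0"
  shows "{x} \<in> null_sets N"
proof -
  interpret real_distribution N by fact
  show ?thesis
    using assms(2) by (simp add: null_sets_def emeasure_eq_measure)
qed

text \<open>The equation \<open>\<Phi> \<circ> F\<^sub>\<mu> = F\<^sub>N\<close> determines \<open>F\<^sub>\<mu>\<close> by injectivity of \<open>\<Phi>\<close>. For existence \<open>\<mu>\<close> is built
  from its quantile function \<open>q\<^sub>N \<circ> \<Phi>\<close>; its c.d.f. at \<open>x\<close> is then the uniform measure of
  \<open>{r. \<Phi> r \<le> F\<^sub>N x}\<close>, that is, the \<open>a\<close> with \<open>\<Phi> a = F\<^sub>N x\<close>.\<close>

theorem gibbs_fixed_point_ex1:
  assumes R: "R \<in> rank_rewards" "0 < \<beta>"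
    and N: "real_distribution N" "\<And>x. measure N {x} = 0"
  shows "\<exists>!\<mu>. real_distribution \<mu> \<and> \<mu> = gibbs_measure \<beta> N (\<lambda>x. R (cdf \<mu> x))"
proof (rule ex_ex1I)
  let ?F = "tilted_rank \<beta> R"
  note F = tilted_rank_cdf[OF R]
  interpret N: real_distribution N by fact
  have inj: "inj_on ?F {0..1}"
    using F(5) by (rule strict_mono_on_imp_inj_on)
  have F01: "?F r \<in> {0<..<1}" if "r \<in> {0<..<1}" for r
    using strict_mono_onD[OF F(5), of 0 r] strict_mono_onD[OF F(5), of r 1] that F(2,3) by auto
  let ?q = "\<lambda>r. quantile N (?F r)"
  interpret U: prob_space uniform_law
    by (rule prob_space_uniform_law)
  have mF: "?F \<in> borel_measurable borel"
    using F(4) by (intro borel_measurable_continuous_onI) (auto simp: continuous_on_eq_continuous_at)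
  have "?F \<in> measurable uniform_law (restrict_space borel {0<..<1})"
    using F01 by (intro measurable_restrict_space2 measurable_restrict_space1)
      (auto simp: space_restrict_space mF)
  then have q: "?q \<in> borel_measurable uniform_law"
    by (rule measurable_compose) (rule quantile_measurable(1)[OF N(1)])
  define \<mu> where "\<mu> = distr uniform_law borel ?q"
  have \<mu>: "real_distribution \<mu>"
    unfolding \<mu>_def using q by (rule U.real_distribution_distr)
  have cdf: "?F (cdf \<mu> x) = cdf N x" for x
  proof -
    have "0 \<le> cdf N x" "cdf N x \<le> 1"
      by (auto simp: N.cdf_nonneg N.cdf_bounded_prob)
    then obtain a where a: "0 \<le> a" "a \<le> 1" "?F a = cdf N x"
      using IVT[of ?F 0 "cdf N x" 1] F(2,3,4) by auto
    have "?q -` {..x} \<inter> {0<..<1} = {r \<in> {0<..<1}. r \<le> a}"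
    proof -
      have "?q r \<le> x \<longleftrightarrow> r \<le> a" if "r \<in> {0<..<1}" for r
        using quantile_le_iff[OF N(1), of "?F r" x] F01[OF that] that a
          strict_mono_on_less_eq[OF F(5), of r a] by auto
      then show ?thesis by auto
    qed
    then have "cdf \<mu> x = measure uniform_law {r \<in> {0<..<1}. r \<le> a}"
      unfolding \<mu>_def using q by (simp add: cdf_def measure_distr space_restrict_space)
    also have "\<dots> = measure lborel {r \<in> {0<..<1}. r \<le> a}"
      by (subst measure_restrict_space) auto
    also have "\<dots> = measure lborel {0<..<a}"
      using a AE_lborel_singleton[of a] by (intro measure_eq_AE) auto
    also have "\<dots> = a"
      using a by simp
    finally show ?thesis
      using a by simp
  qed
  have "measure \<mu> {x} = 0" for x
  proof -
    \<comment> \<open>An atom of \<open>\<mu>\<close> would need many ranks \<open>r\<close> with the same value of \<open>q\<^sub>N (\<Phi> r)\<close>, but applying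
      \<open>F\<^sub>N\<close> to that value recovers \<open>\<Phi> r\<close>, hence \<open>r\<close>.\<close>
    have on_fibre: "?F r = cdf N x" if "r \<in> ?q -` {x} \<inter> {0<..<1}" for r
      using that F01[of r] cdf_quantile[OF N, of "?F r"] by auto
    have "finite (?q -` {x} \<inter> {0<..<1})"
    proof (rule inj_on_finite)
      show "inj_on ?F (?q -` {x} \<inter> {0<..<1})"
        by (rule inj_on_subset[OF inj]) auto
      show "?F ` (?q -` {x} \<inter> {0<..<1}) \<subseteq> {cdf N x}"
        using on_fibre by blast
    qed simp
    then show ?thesis
      unfolding \<mu>_def using q
      by (simp add: measure_distr space_restrict_space measure_restrict_space
          measure_eq_0_null_sets[OF finite_imp_null_set_lborel])
  qed
  then show "\<exists>\<mu>. real_distribution \<mu> \<and> \<mu> = gibbs_measure \<beta> N (\<lambda>x. R (cdf \<mu> x))"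
    using \<mu> cdf gibbs_fixed_point_iff[OF R N(1) \<mu>] by auto

  fix \<mu>1 \<mu>2
  assume \<mu>1: "real_distribution \<mu>1 \<and> \<mu>1 = gibbs_measure \<beta> N (\<lambda>x. R (cdf \<mu>1 x))"
    and \<mu>2: "real_distribution \<mu>2 \<and> \<mu>2 = gibbs_measure \<beta> N (\<lambda>x. R (cdf \<mu>2 x))"
  have *: "?F (cdf \<nu> x) = cdf N x" "cdf \<nu> x \<in> {0..1}"
    if \<nu>: "real_distribution \<nu> \<and> \<nu> = gibbs_measure \<beta> N (\<lambda>x. R (cdf \<nu> x))" for \<nu> x
  proof -
    interpret \<nu>: real_distribution \<nu> using \<nu> by blast
    have "measure (gibbs_measure \<beta> N (\<lambda>x. R (cdf \<nu> x))) {x} = 0" for x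
      unfolding gibbs_measure_def
      using rank_reward_of_cdf(2)[OF R(1) \<nu>.real_distribution_axioms]
      by (intro density_atomless real_distribution_null_singleton N) auto
    then have "measure \<nu> {x} = 0" for x
      using \<nu> by metis
    then show "?F (cdf \<nu> x) = cdf N x"
      using gibbs_fixed_point_iff[OF R N(1)] \<nu> by blast
    show "cdf \<nu> x \<in> {0..1}"
      by (simp add: \<nu>.cdf_nonneg \<nu>.cdf_bounded_prob)
  qed
  have "cdf \<mu>1 x = cdf \<mu>2 x" for x
    by (rule inj_onD[OF inj _ *(2)[OF \<mu>1] *(2)[OF \<mu>2]]) (simp only: *(1)[OF \<mu>1] *(1)[OF \<mu>2])
  then show "\<mu>1 = \<mu>2"
    by (intro cdf_unique conjunct1[OF \<mu>1] conjunct1[OF \<mu>2]) (simp add: fun_eq_iff)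
qed

section \<open>Implementing a given law\<close>

lemma reward_eq_iff_AE_uniform_law:
  "reward_eq R R' \<longleftrightarrow> (AE r in uniform_law. R r = R' r)"
proof -
  have "AE r::real in lborel. r \<noteq> 0 \<and> r \<noteq> 1"
    by (intro AE_conjI AE_lborel_singleton)
  then have "reward_eq R R' \<longleftrightarrow> (AE r in lborel. r \<in> {0<..<1} \<longrightarrow> R r = R' r)"
    unfolding reward_eq_def by (rule eventually_subst[OF eventually_mono]) auto
  also have "\<dots> \<longleftrightarrow> (AE r in uniform_law. R r = R' r)"
    by (subst AE_restrict_space_iff) auto
  finally show ?thesis .
qed

lemma set_integral_unit_interval:
  fixes g :: "real \<Rightarrow> real"
  shows "(LINT r:{0..1}|lborel. g r) = (LINT r|uniform_law. g r)"
proof -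
  have "(LINT r|uniform_law. g r) = (LINT r|lborel. indicator {0<..<1} r *\<^sub>R g r)"
    by (subst integral_restrict_space) auto
  also have "\<dots> = (LINT r:{0..1}|lborel. g r)"
    unfolding set_lebesgue_integral_def
    by (rule integral_discrete_difference[of "{0, 1}"]) (auto simp: indicator_def)
  finally show ?thesis ..
qed

text \<open>Null sets of states for \<open>\<mu>\<close> correspond to Lebesgue null sets of ranks, so the identification of
  rewards almost everywhere is the one that an atomless population sees.\<close>

lemma reward_of_cdf_AE_iff:
  assumes R: "R \<in> rank_rewards" and \<mu>: "real_distribution \<mu>" "\<And>x. measure \<mu> {x} = 0"
    and h: "h \<in> borel_measurable borel"
  shows "(AE x in \<mu>. R (cdf \<mu> x) = h x) \<longleftrightarrow> (AE r in uniform_law. R r = h (quantile \<mu> r))"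
proof -
  have "{x. R (cdf \<mu> x) = h x} \<in> sets borel"
    using rank_reward_of_cdf(2)[OF R \<mu>(1)] h by measurable
  then have "(AE x in \<mu>. R (cdf \<mu> x) = h x) \<longleftrightarrow>
      (AE r in uniform_law. R (cdf \<mu> (quantile \<mu> r)) = h (quantile \<mu> r))"
    by (rule AE_quantile_iff[OF \<mu>(1)])
  also have "\<dots> \<longleftrightarrow> (AE r in uniform_law. R r = h (quantile \<mu> r))"
    by (intro AE_cong) (simp add: space_restrict_space cdf_quantile[OF \<mu>])
  finally show ?thesis .
qed

text \<open>The reward makes \<open>exp (R \<circ> F\<^sub>\<mu> / \<beta>)\<close> equal to \<open>exp (C/\<beta>) \<zeta>\<close> almost everywhere. So its Gibbs
  measure has density \<open>\<zeta>\<close>, and since \<open>\<zeta>\<close> has mass one its partition function is \<open>exp (C/\<beta>)\<close>.\<close>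

lemma gibbs_fixed_point_of_log_density:
  assumes R: "R \<in> rank_rewards" "0 < \<beta>"
    and N: "real_distribution N" and \<mu>: "real_distribution \<mu>" "\<And>x. measure \<mu> {x} = 0"
    and \<zeta>: "\<mu> = density N (\<lambda>x. ennreal (\<zeta> x))" "\<zeta> \<in> borel_measurable borel" "\<And>x. 0 < \<zeta> x"
    and eq: "AE r in uniform_law. R r = \<beta> * ln (\<zeta> (quantile \<mu> r)) + C"
  shows "\<mu> = gibbs_measure \<beta> N (\<lambda>x. R (cdf \<mu> x))"
    and "\<beta> * ln (partition_function \<beta> N (\<lambda>x. R (cdf \<mu> x))) = C"
proof -
  interpret N: real_distribution N by fact
  interpret \<mu>: real_distribution \<mu> by fact
  note h = rank_reward_of_cdf[OF R(1) \<mu>(1)]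
  have "AE x in \<mu>. R (cdf \<mu> x) = \<beta> * ln (\<zeta> x) + C"
    using reward_of_cdf_AE_iff[OF R(1) \<mu>, of "\<lambda>x. \<beta> * ln (\<zeta> x) + C"] eq \<zeta>(2) by simp
  then have "AE x in N. R (cdf \<mu> x) = \<beta> * ln (\<zeta> x) + C"
    unfolding \<zeta>(1) using \<zeta>(2,3) by (subst (asm) AE_density) auto
  then have "AE x in N. \<zeta> x = exp (- C / \<beta>) * exp (R (cdf \<mu> x) / \<beta>)"
  proof eventually_elim
    case (elim x)
    have "exp (- C / \<beta>) * exp (R (cdf \<mu> x) / \<beta>) = exp (ln (\<zeta> x))"
      unfolding elim exp_add[symmetric] using R(2) by (simp add: add_divide_distrib)
    then show ?case
      using \<zeta>(3) by simp
  qed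
  then have "density N (\<lambda>x. ennreal (\<zeta> x)) =
      density N (\<lambda>x. ennreal (exp (- C / \<beta>) * exp (R (cdf \<mu> x) / \<beta>)))"
    using \<zeta>(2) h(2) by (intro density_cong) auto
  then have \<mu>': "\<mu> = density N (\<lambda>x. ennreal (exp (- C / \<beta>) * exp (R (cdf \<mu> x) / \<beta>)))"
    by (simp only: \<zeta>(1)[symmetric])
  have "prob_space (density N (\<lambda>x. ennreal (exp (- C / \<beta>) * exp (R (cdf \<mu> x) / \<beta>))))"
    using \<mu>.prob_space_axioms unfolding \<mu>'[symmetric] .
  note gibbs = density_eq_gibbs_measure[OF N.prob_space_axioms _ _ R(2) exp_gt_zero this]
  have b: "bounded ((\<lambda>x. R (cdf \<mu> x)) ` space N)"
    using h(3) by simp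
  show "\<mu> = gibbs_measure \<beta> N (\<lambda>x. R (cdf \<mu> x))"
    by (rule trans[OF \<mu>' gibbs(2)]) (use h(2) b in auto)
  have "exp (- C / \<beta>) * partition_function \<beta> N (\<lambda>x. R (cdf \<mu> x)) = 1"
    by (rule gibbs(1)) (use h(2) b in auto)
  then have "partition_function \<beta> N (\<lambda>x. R (cdf \<mu> x)) = exp (C / \<beta>)"
    by (simp add: exp_minus field_simps)
  then show "\<beta> * ln (partition_function \<beta> N (\<lambda>x. R (cdf \<mu> x))) = C"
    using R(2) by simp
qed

text \<open>Uniqueness of densities, solved for the reward. The constant is \<open>C = \<beta> ln Z\<close>.\<close>

lemma log_density_of_gibbs_fixed_point:
  assumes R: "R \<in> rank_rewards" "0 < \<beta>"
    and N: "real_distribution N" and \<mu>: "real_distribution \<mu>" "\<And>x. measure \<mu> {x} = 0"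
    and \<zeta>: "\<mu> = density N (\<lambda>x. ennreal (\<zeta> x))" "\<zeta> \<in> borel_measurable borel" "\<And>x. 0 < \<zeta> x"
    and fp: "\<mu> = gibbs_measure \<beta> N (\<lambda>x. R (cdf \<mu> x))"
  shows "\<exists>C. AE r in uniform_law. R r = \<beta> * ln (\<zeta> (quantile \<mu> r)) + C"
proof -
  interpret N: real_distribution N by fact
  let ?Z = "partition_function \<beta> N (\<lambda>x. R (cdf \<mu> x))"
  note h = rank_reward_of_cdf[OF R(1) \<mu>(1)]
  have Z: "0 < ?Z"
    using h R(2) by (intro partition_function_pos[OF N.prob_space_axioms]) auto
  have "density N (\<lambda>x. ennreal (\<zeta> x)) = density N (\<lambda>x. ennreal (exp (R (cdf \<mu> x) / \<beta>) / ?Z))"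
    using \<zeta>(1) fp by (simp add: gibbs_measure_def)
  then have "AE x in N. ennreal (\<zeta> x) = ennreal (exp (R (cdf \<mu> x) / \<beta>) / ?Z)"
    using h(2) \<zeta>(2) by (subst (asm) N.density_unique_iff) auto
  then have "AE x in N. R (cdf \<mu> x) = \<beta> * ln (\<zeta> x) + \<beta> * ln ?Z"
  proof eventually_elim
    case (elim x)
    then have "\<zeta> x = exp (R (cdf \<mu> x) / \<beta>) / ?Z"
      using \<zeta>(3)[of x] Z by (simp add: less_imp_le)
    then have "ln (\<zeta> x) = R (cdf \<mu> x) / \<beta> - ln ?Z"
      using Z by (simp add: ln_div)
    then show ?case
      using R(2) by (simp add: field_simps)
  qed
  then have "AE x in density N (\<lambda>x. ennreal (\<zeta> x)). R (cdf \<mu> x) = \<beta> * ln (\<zeta> x) + \<beta> * ln ?Z"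
    using \<zeta>(2,3) by (subst AE_density) auto
  then have "AE x in \<mu>. R (cdf \<mu> x) = \<beta> * ln (\<zeta> x) + \<beta> * ln ?Z"
    by (simp only: \<zeta>(1)[symmetric])
  then show ?thesis
    using reward_of_cdf_AE_iff[OF R(1) \<mu>, of "\<lambda>x. \<beta> * ln (\<zeta> x) + \<beta> * ln ?Z"] \<zeta>(2) by auto
qed

text \<open>The quantile function has no meaningful value at ranks \<open>0\<close> and \<open>1\<close>. Bounds of \<open>\<zeta>\<close> are inserted
  there to keep the reward monotone.\<close>

lemma implementing_rank_reward_exists:
  assumes \<mu>: "real_distribution \<mu>" and "0 < c"
    and \<zeta>: "mono \<zeta>" "0 < a" "\<And>x. a \<le> \<zeta> x" "\<And>x. \<zeta> x \<le> b"
  shows "\<exists>R\<in>rank_rewards. reward_eq R (implementing_reward \<sigma> c \<mu> \<zeta> C)"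
proof -
  define k where "k r = (if r \<le> 0 then a else if r < 1 then \<zeta> (quantile \<mu> r) else b)" for r
  define R where "R r = 2 * c * \<sigma>\<^sup>2 * ln (k r) + C" for r
  have k: "a \<le> k r" "k r \<le> b" for r
    using \<zeta>(3,4) order_trans[OF \<zeta>(3,4)] by (auto simp: k_def)
  have kpos: "0 < k r" for r
    using k(1)[of r] \<zeta>(2) by linarith
  have "quantile \<mu> r \<le> quantile \<mu> s" if "0 < r" "r \<le> s" "s < 1" for r s
    using quantile_le_iff[OF \<mu>, of r "quantile \<mu> s"] quantile_le_iff[OF \<mu>, of s "quantile \<mu> s"] that
    by auto
  then have "k r \<le> k s" if "r \<le> s" for r s
    using that \<zeta>(3,4) order_trans[OF \<zeta>(3,4)] by (auto simp: k_def intro: monoD[OF \<zeta>(1)])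
  then have "mono_on {0..1} R"
    using \<open>0 < c\<close> kpos by (auto simp: R_def intro!: mono_onI mult_left_mono)
  moreover have "R r \<in> {2 * c * \<sigma>\<^sup>2 * ln a + C .. 2 * c * \<sigma>\<^sup>2 * ln b + C}" for r
    using \<open>0 < c\<close> kpos k[of r] \<zeta>(2) less_le_trans[OF kpos k(2)]
    by (auto simp: R_def intro!: mult_left_mono)
  then have "bounded (R ` {0..1})"
    by (intro bounded_subset[OF bounded_closed_interval]) blast
  moreover have "R r = implementing_reward \<sigma> c \<mu> \<zeta> C r" if "r \<in> {0<..<1}" for r
    using that by (simp add: R_def k_def implementing_reward_def)
  then have "reward_eq R (implementing_reward \<sigma> c \<mu> \<zeta> C)"
    unfolding reward_eq_iff_AE_uniform_law by (intro AE_I2) (simp add: space_restrict_space)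
  ultimately show ?thesis
    by (auto simp: rank_rewards_def)
qed

section \<open>Attainable laws and their implementing rewards\<close>

lemma ref_density_law:
  assumes "0 < T" "0 < \<sigma>"
  shows "real_distribution (density lborel (ref_density T \<sigma> x0))"
    and "measure (density lborel (ref_density T \<sigma> x0)) {x} = 0"
    and "ref_density T \<sigma> x0 \<in> borel_measurable borel"
    and "0 < ref_density T \<sigma> x0 y"
proof -
  have "0 < \<sigma> * sqrt T"
    using assms by simp
  then interpret N: prob_space "density lborel (ref_density T \<sigma> x0)"
    unfolding ref_density_def by (rule prob_space_normal_density)
  show "real_distribution (density lborel (ref_density T \<sigma> x0))"
    by (intro real_distribution.intro N.prob_space_axioms) (simp add: real_distribution_axioms_def)
  show f: "ref_density T \<sigma> x0 \<in> borel_measurable borel"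
    by (simp add: ref_density_def)
  show "measure (density lborel (ref_density T \<sigma> x0)) {x} = 0"
    using f by (intro density_atomless finite_imp_null_set_lborel) auto
  show "0 < ref_density T \<sigma> x0 y"
    using \<open>0 < \<sigma> * sqrt T\<close> by (simp add: ref_density_def normal_density_pos)
qed

lemma equilibrium_eq_iff:
  fixes c \<sigma> :: real
  assumes "0 < T" "0 < \<sigma>" "0 < c" "prob_space P" "sets P = sets (path_space T)"
    and N: "terminal_law T P = N" "real_distribution N" "\<And>x. measure N {x} = 0"
    and R: "R \<in> rank_rewards"
  shows "equilibrium T \<sigma> c P R = \<mu> \<longleftrightarrow>
           real_distribution \<mu> \<and> \<mu> = gibbs_measure (2 * c * \<sigma>\<^sup>2) N (\<lambda>x. R (cdf \<mu> x))"
proof -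
  have ex1: "\<exists>!\<mu>. is_equilibrium T \<sigma> c P R \<mu>"
    unfolding is_equilibrium_iff_gibbs_measure[OF assms(1-5) R] N(1)
    using assms(2,3) by (intro gibbs_fixed_point_ex1[OF R _ N(2,3)]) simp
  have "equilibrium T \<sigma> c P R = \<mu> \<longleftrightarrow> is_equilibrium T \<sigma> c P R \<mu>"
    unfolding equilibrium_def using theI'[OF ex1] the1_equality[OF ex1] by blast
  then show ?thesis
    unfolding is_equilibrium_iff_gibbs_measure[OF assms(1-5) R] N(1) .
qed

lemma admissible_version_density:
  assumes "0 < T" "0 < \<sigma>" "admissible_version T \<sigma> x0 \<mu> \<zeta>"
  shows "\<mu> = density (density lborel (ref_density T \<sigma> x0)) (\<lambda>x. ennreal (\<zeta> x))"
    and "\<zeta> \<in> borel_measurable borel" and "\<And>x. 0 < \<zeta> x" and "mono \<zeta>"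
    and "\<exists>a b. 0 < a \<and> (\<forall>x. a \<le> \<zeta> x \<and> \<zeta> x \<le> b)"
proof -
  note f0 = ref_density_law[OF assms(1,2), of x0]
  obtain f where f: "positive_density \<mu> f" and \<zeta>: "\<zeta> = (\<lambda>x. f x / ref_density T \<sigma> x0 x)"
    using assms(3) by (auto simp: admissible_version_def normalized_density_def)
  have f': "f \<in> borel_measurable borel" "\<And>x. 0 < f x" "\<mu> = density lborel f"
    using f by (auto simp: positive_density_def)
  show m: "\<zeta> \<in> borel_measurable borel" and pos: "\<And>x. 0 < \<zeta> x"
    using f' f0(3,4) by (auto simp: \<zeta>)
  show "mono \<zeta>"
    using assms(3) by (simp add: admissible_version_def)
  have "f x = ref_density T \<sigma> x0 x * \<zeta> x" for x
    using f0(4)[of x] by (simp add: \<zeta>)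
  then show "\<mu> = density (density lborel (ref_density T \<sigma> x0)) (\<lambda>x. ennreal (\<zeta> x))"
    using m f0(3,4) pos by (subst density_density_eq) (auto simp: f'(3) ennreal_mult[symmetric] less_imp_le)
  obtain b where b: "\<And>x. \<bar>\<zeta> x\<bar> \<le> b"
    using assms(3) by (auto simp: admissible_version_def bounded_iff)
  obtain d where d: "\<And>x. \<bar>1 / \<zeta> x\<bar> \<le> d"
    using assms(3) by (auto simp: admissible_version_def bounded_iff)
  have d': "1 / \<zeta> x \<le> d" for x
    using d[of x] by linarith
  have "0 < 1 / \<zeta> 0"
    using pos by simp
  then have "0 < d"
    using d'[of 0] by linarith
  moreover have "1 / d \<le> \<zeta> x \<and> \<zeta> x \<le> b" for x
    using d'[of x] b[of x] pos[of x] \<open>0 < d\<close> by (simp add: field_simps)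
  ultimately show "\<exists>a b. 0 < a \<and> (\<forall>x. a \<le> \<zeta> x \<and> \<zeta> x \<le> b)"
    by (intro exI[of _ "1 / d"] exI[of _ b]) simp
qed

text \<open>This gives the necessary conditions on an attainable law: its normalized density
  \<open>exp (R \<circ> F\<^sub>\<mu> / \<beta>) / Z\<close> is an increasing function of the bounded increasing \<open>R \<circ> F\<^sub>\<mu>\<close>.\<close>

lemma gibbs_measure_admissible:
  assumes "0 < T" "0 < \<sigma>" "0 < \<beta>" "mono g" "bounded (range g)"
    and \<mu>: "\<mu> = gibbs_measure \<beta> (density lborel (ref_density T \<sigma> x0)) g"
  shows "\<mu> \<in> positive_laws" "\<exists>\<zeta>. admissible_version T \<sigma> x0 \<mu> \<zeta>"
proof -
  note f0 = ref_density_law[OF assms(1,2), of x0]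
  let ?N = "density lborel (ref_density T \<sigma> x0)"
  let ?Z = "partition_function \<beta> ?N g"
  interpret N: real_distribution ?N
    by (rule f0(1))
  have g: "g \<in> borel_measurable borel"
    using assms(4) by (rule borel_measurable_mono)
  have Z: "0 < ?Z"
    using g assms(3,5) by (intro partition_function_pos[OF N.prob_space_axioms]) auto
  have "prob_space \<mu>"
    using gibbs_measure_equivalent[OF N.prob_space_axioms, of g \<beta>] g assms(3,5)
    by (simp add: \<mu> equivalent_laws_def)
  define \<zeta> where "\<zeta> x = exp (g x / \<beta>) / ?Z" for x
  have \<zeta>pos: "0 < \<zeta> x" for x
    using Z by (simp add: \<zeta>_def)
  have m: "\<zeta> \<in> borel_measurable borel"
    using g by (simp add: \<zeta>_def[abs_def])
  have "\<mu> = density lborel (\<lambda>x. ennreal (ref_density T \<sigma> x0 x * \<zeta> x))"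
    unfolding \<mu> gibbs_measure_def \<zeta>_def[symmetric] using m f0(3,4) \<zeta>pos
    by (subst density_density_eq) (auto simp: ennreal_mult[symmetric] less_imp_le)
  then have pd: "positive_density \<mu> (\<lambda>x. ref_density T \<sigma> x0 x * \<zeta> x)"
    using m f0(3,4) \<zeta>pos by (simp add: positive_density_def)
  then show "\<mu> \<in> positive_laws"
    using \<open>prob_space \<mu>\<close> by (auto simp: positive_laws_def positive_density_def)
  have "normalized_density T \<sigma> x0 \<mu> \<zeta>"
    unfolding normalized_density_def
    using pd f0(4) by (intro exI[of _ "\<lambda>x. ref_density T \<sigma> x0 x * \<zeta> x"]) (auto simp: less_imp_neq[THEN not_sym])
  moreover have "mono \<zeta>"
    using assms(3) Z monoD[OF assms(4)] by (auto simp: \<zeta>_def intro!: monoI divide_right_mono)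
  moreover obtain b where b: "\<And>x. \<bar>g x\<bar> \<le> b"
    using assms(5) by (auto simp: bounded_iff)
  have "\<bar>g x / \<beta>\<bar> \<le> b / \<beta>" for x
    using b[of x] assms(3) by (simp add: divide_right_mono)
  then have gb: "g x / \<beta> \<le> b / \<beta>" "- (b / \<beta>) \<le> g x / \<beta>" for x
    by (smt (verit))+
  have "\<bar>\<zeta> x\<bar> \<le> exp (b / \<beta>) / ?Z" for x
    using gb(1)[of x] Z by (simp add: \<zeta>_def divide_right_mono)
  then have "bounded (range \<zeta>)"
    by (auto simp: bounded_iff)
  moreover have "\<bar>1 / \<zeta> x\<bar> \<le> ?Z * exp (b / \<beta>)" for x
    using gb(2)[of x] Z by (simp add: \<zeta>_def exp_minus[symmetric] divide_inverse mult_left_mono)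
  then have "bounded (range (\<lambda>x. 1 / \<zeta> x))"
    by (auto simp: bounded_iff)
  ultimately show "\<exists>\<zeta>. admissible_version T \<sigma> x0 \<mu> \<zeta>"
    by (auto simp: admissible_version_def)
qed

lemma admissible_law_atomless:
  assumes "0 < T" "0 < \<sigma>" "prob_space \<mu>" "admissible_version T \<sigma> x0 \<mu> \<zeta>"
  shows "real_distribution \<mu>" "measure \<mu> {x} = 0"
proof -
  note f0 = ref_density_law[OF assms(1,2), of x0]
  note \<zeta> = admissible_version_density[OF assms(1,2,4)]
  have "sets \<mu> = sets borel"
    by (simp add: \<zeta>(1))
  with assms(3) show "real_distribution \<mu>"
    by (simp add: real_distribution_def real_distribution_axioms_def)
  show "measure \<mu> {x} = 0"
    unfolding \<zeta>(1) using \<zeta>(2)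
    by (intro density_atomless real_distribution_null_singleton f0) auto
qed

lemma equilibrium_of_implementing_reward:
  fixes c \<sigma> :: real
  assumes "0 < T" "0 < \<sigma>" "0 < c" "prob_space P" "sets P = sets (path_space T)"
    and N: "terminal_law T P = density lborel (ref_density T \<sigma> x0)"
    and \<mu>: "prob_space \<mu>" "admissible_version T \<sigma> x0 \<mu> \<zeta>"
    and R: "R \<in> rank_rewards"
  shows "equilibrium T \<sigma> c P R = \<mu> \<longleftrightarrow> (\<exists>C. reward_eq R (implementing_reward \<sigma> c \<mu> \<zeta> C))"
    and "reward_eq R (implementing_reward \<sigma> c \<mu> \<zeta> C) \<Longrightarrow> game_value T \<sigma> c P R = ereal C"
proof -
  define \<beta> where "\<beta> = 2 * c * \<sigma>\<^sup>2"
  have \<beta>: "0 < \<beta>"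
    using assms(2,3) by (simp add: \<beta>_def)
  let ?N = "density lborel (ref_density T \<sigma> x0)"
  note f0 = ref_density_law[OF assms(1,2), of x0]
  note \<zeta> = admissible_version_density[OF assms(1,2) \<mu>(2)]
  note \<mu>' = admissible_law_atomless[OF assms(1,2) \<mu>]
  note eq = equilibrium_eq_iff[OF assms(1-5) N f0(1,2) R, folded \<beta>_def]
  note to_gibbs = gibbs_fixed_point_of_log_density[OF R \<beta> f0(1) \<mu>' \<zeta>(1-3)]
  have rew: "reward_eq R (implementing_reward \<sigma> c \<mu> \<zeta> C) \<longleftrightarrow>
      (AE r in uniform_law. R r = \<beta> * ln (\<zeta> (quantile \<mu> r)) + C)" for C
    by (simp add: reward_eq_iff_AE_uniform_law implementing_reward_def \<beta>_def)
  show iff: "equilibrium T \<sigma> c P R = \<mu> \<longleftrightarrow> (\<exists>C. reward_eq R (implementing_reward \<sigma> c \<mu> \<zeta> C))"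
  proof
    assume "equilibrium T \<sigma> c P R = \<mu>"
    then have "\<mu> = gibbs_measure \<beta> ?N (\<lambda>x. R (cdf \<mu> x))"
      using eq by blast
    then show "\<exists>C. reward_eq R (implementing_reward \<sigma> c \<mu> \<zeta> C)"
      unfolding rew by (rule log_density_of_gibbs_fixed_point[OF R \<beta> f0(1) \<mu>' \<zeta>(1-3)])
  next
    assume "\<exists>C. reward_eq R (implementing_reward \<sigma> c \<mu> \<zeta> C)"
    then obtain C where "AE r in uniform_law. R r = \<beta> * ln (\<zeta> (quantile \<mu> r)) + C"
      unfolding rew by blast
    from to_gibbs(1)[OF this] show "equilibrium T \<sigma> c P R = \<mu>"
      using eq \<mu>'(1) by blast
  qed
  assume C: "reward_eq R (implementing_reward \<sigma> c \<mu> \<zeta> C)"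
  with iff have "equilibrium T \<sigma> c P R = \<mu>"
    by blast
  then have "game_value T \<sigma> c P R = ereal (\<beta> * ln (partition_function \<beta> ?N (\<lambda>x. R (cdf \<mu> x))))"
    unfolding game_value_def using best_response(1)[OF assms(1-5) R \<mu>'(1)] by (simp add: N \<beta>_def)
  also have "\<dots> = ereal C"
    using to_gibbs(2) C unfolding rew by simp
  finally show "game_value T \<sigma> c P R = ereal C" .
qed

lemma log_density_integral:
  assumes "0 < T" "0 < \<sigma>" "prob_space \<mu>" "admissible_version T \<sigma> x0 \<mu> \<zeta>"
  shows "integrable \<mu> (\<lambda>y. ln (\<zeta> y))"
    and "relative_entropy \<mu> (density lborel (ref_density T \<sigma> x0)) = ereal (LINT y|\<mu>. ln (\<zeta> y))"
    and "(LINT y|\<mu>. ln (\<zeta> y)) = (LINT r|uniform_law. ln (\<zeta> (quantile \<mu> r)))"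
    and "integrable uniform_law (\<lambda>r. ln (\<zeta> (quantile \<mu> r)))"
proof -
  let ?N = "density lborel (ref_density T \<sigma> x0)"
  note f0 = ref_density_law[OF assms(1,2), of x0]
  note \<zeta> = admissible_version_density[OF assms(1,2,4)]
  note \<mu> = admissible_law_atomless(1)[OF assms]
  interpret \<mu>: real_distribution \<mu> by fact
  obtain a b where ab: "0 < a" "\<And>x. a \<le> \<zeta> x" "\<And>x. \<zeta> x \<le> b"
    using \<zeta>(5) by blast
  have "norm (ln (\<zeta> x)) \<le> max \<bar>ln a\<bar> \<bar>ln b\<bar>" for x
  proof -
    have "ln a \<le> ln (\<zeta> x)" "ln (\<zeta> x) \<le> ln b"
      using ab \<zeta>(3)[of x] less_le_trans[OF \<zeta>(3) ab(3)] by auto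
    then show ?thesis by auto
  qed
  then show int: "integrable \<mu> (\<lambda>y. ln (\<zeta> y))"
    using \<zeta>(2) by (intro \<mu>.integrable_const_bound[of _ "max \<bar>ln a\<bar> \<bar>ln b\<bar>"] AE_I2) auto
  have "prob_space ?N"
    using f0(1) by (simp add: real_distribution_def)
  then have "relative_entropy (density ?N (\<lambda>x. ennreal (\<zeta> x))) ?N =
      ereal (LINT y|density ?N (\<lambda>x. ennreal (\<zeta> x)). ln (\<zeta> y))"
    by (rule relative_entropy_density)
      (use assms(3) int \<zeta>(2) less_imp_le[OF \<zeta>(3)] in \<open>auto simp: \<zeta>(1)[symmetric]\<close>)
  then show "relative_entropy \<mu> ?N = ereal (LINT y|\<mu>. ln (\<zeta> y))"
    by (simp only: \<zeta>(1)[symmetric])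
  have "(LINT y|distr uniform_law borel (quantile \<mu>). ln (\<zeta> y)) = (LINT r|uniform_law. ln (\<zeta> (quantile \<mu> r)))"
    using \<zeta>(2) by (intro integral_distr quantile_measurable \<mu>) auto
  then show "(LINT y|\<mu>. ln (\<zeta> y)) = (LINT r|uniform_law. ln (\<zeta> (quantile \<mu> r)))"
    unfolding distr_quantile[OF \<mu>] .
  have "integrable (distr uniform_law borel (quantile \<mu>)) (\<lambda>y. ln (\<zeta> y))"
    unfolding distr_quantile[OF \<mu>] by (rule int)
  then show "integrable uniform_law (\<lambda>r. ln (\<zeta> (quantile \<mu> r)))"
    by (rule integrable_distr[OF quantile_measurable(2)[OF \<mu>]])
qed

text \<open>The quantile map turns the integral over ranks into one over states, where the reward
  averages to \<open>\<beta>\<close> times the relative entropy plus \<open>C\<close>.\<close>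

lemma implementing_reward_cost:
  assumes "0 < T" "0 < \<sigma>" "prob_space \<mu>" "admissible_version T \<sigma> x0 \<mu> \<zeta>"
    and R: "R \<in> rank_rewards" "reward_eq R (implementing_reward \<sigma> c \<mu> \<zeta> C)"
  shows "(LINT r:{0..1}|lborel. R r) = 2 * c * \<sigma>\<^sup>2 * (LINT y|\<mu>. ln (\<zeta> y)) + C"
proof -
  interpret U: prob_space uniform_law
    by (rule prob_space_uniform_law)
  note L = log_density_integral[OF assms(1-4)]
  have int: "integrable uniform_law (\<lambda>r. 2 * c * \<sigma>\<^sup>2 * ln (\<zeta> (quantile \<mu> r)))"
    using L(4) by (rule integrable_mult_right)
  have "(LINT r:{0..1}|lborel. R r) = (LINT r|uniform_law. R r)"
    by (rule set_integral_unit_interval)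
  also have "\<dots> = (LINT r|uniform_law. 2 * c * \<sigma>\<^sup>2 * ln (\<zeta> (quantile \<mu> r)) + C)"
    using R(2) unfolding reward_eq_iff_AE_uniform_law implementing_reward_def
    by (intro integral_cong_AE rank_reward_on_uniform_law R borel_measurable_integrable
        Bochner_Integration.integrable_add int U.integrable_const)
  also have "\<dots> = 2 * c * \<sigma>\<^sup>2 * (LINT y|\<mu>. ln (\<zeta> y)) + C"
    unfolding L(3) using int U.prob_space by simp
  finally show ?thesis .
qed

theorem theorem5p1:
  fixes T \<sigma> c x0 :: real
    and M :: "'w measure" and B :: "real \<Rightarrow> 'w \<Rightarrow> real"
    and P :: "(real \<Rightarrow> real) measure"
  assumes "0 < T" and "0 < \<sigma>" and "0 < c"
    and "standard_brownian_motion T M B"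
    and "P = reference_law T \<sigma> x0 M B"
  shows
    "(equilibrium T \<sigma> c P ` rank_rewards =
        {\<mu> \<in> positive_laws. \<exists>\<zeta>. admissible_version T \<sigma> x0 \<mu> \<zeta>}) \<and>
     (\<forall>\<mu> \<in> equilibrium T \<sigma> c P ` rank_rewards. \<forall>\<zeta>. admissible_version T \<sigma> x0 \<mu> \<zeta> \<longrightarrow>
        {R \<in> rank_rewards. equilibrium T \<sigma> c P R = \<mu>} =
          {R \<in> rank_rewards. \<exists>C. reward_eq R (implementing_reward \<sigma> c \<mu> \<zeta> C)} \<and>
        (\<forall>C. \<exists>R\<in>rank_rewards. reward_eq R (implementing_reward \<sigma> c \<mu> \<zeta> C))) \<and>
     (\<forall>\<mu> \<in> equilibrium T \<sigma> c P ` rank_rewards. \<forall>\<zeta>. admissible_version T \<sigma> x0 \<mu> \<zeta> \<longrightarrow>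
        (\<forall>V0 K :: real.
          let H = relative_entropy \<mu> (density lborel (ref_density T \<sigma> x0)) in
          (\<forall>C. \<forall>R\<in>rank_rewards. reward_eq R (implementing_reward \<sigma> c \<mu> \<zeta> C) \<longrightarrow>
             (ereal V0 \<le> game_value T \<sigma> c P R \<and> (LINT r:{0..1}|lborel. R r) \<le> K \<longleftrightarrow>
              V0 \<le> C \<and> ereal C \<le> ereal K - ereal (2 * c * \<sigma>\<^sup>2) * H)) \<and>
          H = ereal (LINT y|\<mu>. ln (\<zeta> y)) \<and>
          (LINT y|\<mu>. ln (\<zeta> y)) = (LINT r:{0..1}|lborel. ln (\<zeta> (quantile \<mu> r))) \<and>
          ((\<exists>C. \<exists>R\<in>rank_rewards. reward_eq R (implementing_reward \<sigma> c \<mu> \<zeta> C) \<and>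
              ereal V0 \<le> game_value T \<sigma> c P R \<and> (LINT r:{0..1}|lborel. R r) \<le> K) \<longleftrightarrow>
           H \<le> ereal ((K - V0) / (2 * c * \<sigma>\<^sup>2)))))"
proof -
  have P: "prob_space P" "sets P = sets (path_space T)"
    "terminal_law T P = density lborel (ref_density T \<sigma> x0)"
    using reference_law_terminal[OF assms(1,2,4)] assms(5) by simp_all
  define \<beta> where "\<beta> = 2 * c * \<sigma>\<^sup>2"
  have \<beta>: "0 < \<beta>"
    using assms(2,3) by (simp add: \<beta>_def)
  note f0 = ref_density_law[OF assms(1,2), of x0]
  note impl = equilibrium_of_implementing_reward[OF assms(1-3) P]
  have exR: "\<exists>R\<in>rank_rewards. reward_eq R (implementing_reward \<sigma> c \<mu> \<zeta> C)"
    if "prob_space \<mu>" "admissible_version T \<sigma> x0 \<mu> \<zeta>" for \<mu> \<zeta> C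
  proof -
    note \<zeta> = admissible_version_density[OF assms(1,2) that(2)]
    obtain a b where "0 < a" "\<And>x. a \<le> \<zeta> x" "\<And>x. \<zeta> x \<le> b"
      using \<zeta>(5) by blast
    then show ?thesis
      by (intro implementing_rank_reward_exists admissible_law_atomless(1)[OF assms(1,2) that]
          assms(3) \<zeta>(4))
  qed
  have attained: "equilibrium T \<sigma> c P R \<in> positive_laws \<and>
      (\<exists>\<zeta>. admissible_version T \<sigma> x0 (equilibrium T \<sigma> c P R) \<zeta>)" if R: "R \<in> rank_rewards" for R
  proof -
    define \<mu> where "\<mu> = equilibrium T \<sigma> c P R"
    have \<mu>: "real_distribution \<mu>"
      "\<mu> = gibbs_measure \<beta> (density lborel (ref_density T \<sigma> x0)) (\<lambda>x. R (cdf \<mu> x))"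
      using equilibrium_eq_iff[OF assms(1-3) P f0(1,2) R, of \<mu>] by (simp_all add: \<mu>_def \<beta>_def)
    note g = rank_reward_of_cdf[OF R \<mu>(1)]
    show ?thesis
      using gibbs_measure_admissible[OF assms(1,2) \<beta> g(1,3) \<mu>(2)] unfolding \<mu>_def by blast
  qed
  have part1: "equilibrium T \<sigma> c P ` rank_rewards =
      {\<mu> \<in> positive_laws. \<exists>\<zeta>. admissible_version T \<sigma> x0 \<mu> \<zeta>}"
  proof (intro set_eqI iffI)
    fix \<mu> assume "\<mu> \<in> equilibrium T \<sigma> c P ` rank_rewards"
    then show "\<mu> \<in> {\<mu> \<in> positive_laws. \<exists>\<zeta>. admissible_version T \<sigma> x0 \<mu> \<zeta>}"
      using attained by blast
  next
    fix \<mu> assume "\<mu> \<in> {\<mu> \<in> positive_laws. \<exists>\<zeta>. admissible_version T \<sigma> x0 \<mu> \<zeta>}"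
    then obtain \<zeta> where \<mu>: "prob_space \<mu>" "admissible_version T \<sigma> x0 \<mu> \<zeta>"
      by (auto simp: positive_laws_def)
    from exR[OF \<mu>, of 0] obtain R where R: "R \<in> rank_rewards"
        "reward_eq R (implementing_reward \<sigma> c \<mu> \<zeta> 0)"
      by blast
    then have "equilibrium T \<sigma> c P R = \<mu>"
      using impl(1)[OF \<mu> R(1)] by blast
    with R(1) show "\<mu> \<in> equilibrium T \<sigma> c P ` rank_rewards"
      by blast
  qed
  then have prob: "prob_space \<mu>" if "\<mu> \<in> equilibrium T \<sigma> c P ` rank_rewards" for \<mu>
    using that by (auto simp: positive_laws_def)
  have part2: "{R \<in> rank_rewards. equilibrium T \<sigma> c P R = \<mu>} =
          {R \<in> rank_rewards. \<exists>C. reward_eq R (implementing_reward \<sigma> c \<mu> \<zeta> C)}"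
      "\<forall>C. \<exists>R\<in>rank_rewards. reward_eq R (implementing_reward \<sigma> c \<mu> \<zeta> C)"
    if "prob_space \<mu>" "admissible_version T \<sigma> x0 \<mu> \<zeta>" for \<mu> \<zeta>
    using impl(1)[OF that] exR[OF that] by blast+
  have part3: "let H = relative_entropy \<mu> (density lborel (ref_density T \<sigma> x0)) in
          (\<forall>C. \<forall>R\<in>rank_rewards. reward_eq R (implementing_reward \<sigma> c \<mu> \<zeta> C) \<longrightarrow>
             (ereal V0 \<le> game_value T \<sigma> c P R \<and> (LINT r:{0..1}|lborel. R r) \<le> K \<longleftrightarrow>
              V0 \<le> C \<and> ereal C \<le> ereal K - ereal (2 * c * \<sigma>\<^sup>2) * H)) \<and>
          H = ereal (LINT y|\<mu>. ln (\<zeta> y)) \<and>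
          (LINT y|\<mu>. ln (\<zeta> y)) = (LINT r:{0..1}|lborel. ln (\<zeta> (quantile \<mu> r))) \<and>
          ((\<exists>C. \<exists>R\<in>rank_rewards. reward_eq R (implementing_reward \<sigma> c \<mu> \<zeta> C) \<and>
              ereal V0 \<le> game_value T \<sigma> c P R \<and> (LINT r:{0..1}|lborel. R r) \<le> K) \<longleftrightarrow>
           H \<le> ereal ((K - V0) / (2 * c * \<sigma>\<^sup>2)))"
    if \<mu>: "prob_space \<mu>" "admissible_version T \<sigma> x0 \<mu> \<zeta>" for \<mu> \<zeta> V0 K
  proof -
    define h where "h = (LINT y|\<mu>. ln (\<zeta> y))"
    note L = log_density_integral[OF assms(1,2) \<mu>, folded h_def]
    have constraints: "ereal V0 \<le> game_value T \<sigma> c P R \<and> (LINT r:{0..1}|lborel. R r) \<le> K \<longleftrightarrow>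
        V0 \<le> C \<and> C \<le> K - \<beta> * h"
      if "R \<in> rank_rewards" "reward_eq R (implementing_reward \<sigma> c \<mu> \<zeta> C)" for R C
      unfolding impl(2)[OF \<mu> that]
        implementing_reward_cost[OF assms(1,2) \<mu> that, folded h_def \<beta>_def] by auto
    \<comment> \<open>Both constraints depend on the representative \<open>R\<close> only through \<open>C\<close>, and every \<open>C\<close> has one.\<close>
    have "(\<exists>C. \<exists>R\<in>rank_rewards. reward_eq R (implementing_reward \<sigma> c \<mu> \<zeta> C) \<and>
        ereal V0 \<le> game_value T \<sigma> c P R \<and> (LINT r:{0..1}|lborel. R r) \<le> K) \<longleftrightarrow>
        (\<exists>C. V0 \<le> C \<and> C \<le> K - \<beta> * h)"
      using constraints exR[OF \<mu>] by meson
    also have "\<dots> \<longleftrightarrow> V0 \<le> K - \<beta> * h"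
      using order_trans by blast
    also have "\<dots> \<longleftrightarrow> h \<le> (K - V0) / \<beta>"
      using \<beta> by (simp add: pos_le_divide_eq mult.commute le_diff_eq add.commute)
    finally have ex: "(\<exists>C. \<exists>R\<in>rank_rewards. reward_eq R (implementing_reward \<sigma> c \<mu> \<zeta> C) \<and>
        ereal V0 \<le> game_value T \<sigma> c P R \<and> (LINT r:{0..1}|lborel. R r) \<le> K) \<longleftrightarrow> h \<le> (K - V0) / \<beta>" .
    show ?thesis
      unfolding Let_def L(2) \<beta>_def[symmetric] h_def[symmetric] ex
      using constraints L(3) by (auto simp: set_integral_unit_interval)
  qed
  show ?thesis
    by (intro conjI ballI allI impI part1 part2 part3 prob)
qed

end
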